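(* Let $\mathcal H\subset\{\mathbb R^d\to\mathbb R^r\}$ and $\mathcal F^{\mathrm p}\subset\{\mathbb R^r\to\mathbb R^{k-1}\}$ be function classes such that every $f\in\mathcal F^{\mathrm p}$ is $L(\mathcal F^{\mathrm p})$-Lipschitz with respect to the Euclidean distance and $\|f\circ h(x)\|\le D_{\mathcal X^{\mathrm p}}$ for all $x\in\mathcal X^{\mathrm p}\subset\mathbb R^d$, $h\in\mathcal H$, $f\in\mathcal F^{\mathrm p}$. Then for inputs $x_1^{\mathrm p},\dots,x_n^{\mathrm p}\in\mathcal X^{\mathrm p}$ the empirical vector-form Gaussian complexities satisfy $$\hat G_n(\mathcal F^{\mathrm p}\circ\mathcal H)\le\frac{8\sqrt{k-1}\,D_{\mathcal X^{\mathrm p}}}{n^2}+512\,C(\mathcal F^{\mathrm p}\circ\mathcal H)\cdot\log(n),$$ where $C(\mathcal F^{\mathrm p}\circ\mathcal H)=L(\mathcal F^{\mathrm p})\cdot\hat G_n(\mathcal H)+\bar G_n(\mathcal F^{\mathrm p})$.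
   Context: $\mathcal F^{\mathrm p}\circ\mathcal H=\{f\circ h: f\in\mathcal F^{\mathrm p},h\in\mathcal H\}$. For a class $\mathcal Q$ of functions into $\mathbb R^q$ and points $x_1,\dots,x_n$, the empirical Gaussian complexity is $\hat G_n(\mathcal Q)=\mathbb E_g\big[\sup_{Q\in\mathcal Q}\frac1n\sum_{j=1}^q\sum_{i=1}^n g_{ji}Q_j(x_i)\big]$ with $g_{ji}$ i.i.d. $\mathcal N(0,1)$ and $Q_j$ the $j$-th coordinate of $Q$. Here $\hat G_n(\mathcal F^{\mathrm p}\circ\mathcal H)$ and $\hat G_n(\mathcal H)$ are taken at the same points $x_1^{\mathrm p},\dots,x_n^{\mathrm p}$. The worst-case complexity $\bar G_n(\mathcal F^{\mathrm p})$ is the maximum, over $h\in\mathcal H$ and $x_1,\dots,x_n\in\mathcal X^{\mathrm p}$, of the empirical Gaussian complexity of $\mathcal F^{\mathrm p}$ at the points $h(x_1),\dots,h(x_n)\in\mathbb R^r$. *)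

theory Defs
  imports "HOL-Probability.Probability"
begin

(* Expectation of an extended-real random variable as the expectation of its positive part minus
   that of its negative part.  Extended values are needed because the complexity of an unbounded
   class is infinite.  For a nonempty class the negative part of the supremum below is dominated
   by an integrable function, so the case \<infinity> - \<infinity> does not arise; for the empty
   class the result is -\<infinity>. *)
definition ereal_expectation :: "'w measure \<Rightarrow> ('w \<Rightarrow> ereal) \<Rightarrow> ereal" where
  "ereal_expectation M Z =
     enn2ereal (\<integral>\<^sup>+ w. e2ennreal (Z w) \<partial>M)
     - enn2ereal (\<integral>\<^sup>+ w. e2ennreal (- Z w) \<partial>M)"

(* The family g(j,i) of i.i.d. N(0,1) variables is realised as the coordinates of a product
   measure; 'q indexes the coordinates of R^q. *)
definition iid_std_normal :: "nat \<Rightarrow> ('q::finite \<times> nat \<Rightarrow> real) measure" where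
  "iid_std_normal n = Pi\<^sub>M (UNIV \<times> {1..n}) (\<lambda>_. std_normal_distribution)"

definition emp_gaussian_complexity ::
    "nat \<Rightarrow> (nat \<Rightarrow> 'a) \<Rightarrow> ('a \<Rightarrow> real ^ 'q) set \<Rightarrow> ereal" where
  "emp_gaussian_complexity n x \<Q> =
     ereal_expectation (iid_std_normal n)
       (\<lambda>g. SUP Q\<in>\<Q>. ereal (1 / real n * (\<Sum>j\<in>UNIV. \<Sum>i=1..n. g (j, i) * Q (x i) $ j)))"

definition class_comp :: "('b \<Rightarrow> 'c) set \<Rightarrow> ('a \<Rightarrow> 'b) set \<Rightarrow> ('a \<Rightarrow> 'c) set" where
  "class_comp \<F> \<H> = {f \<circ> h | f h. f \<in> \<F> \<and> h \<in> \<H>}"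

(* The "maximum" over representations and inputs is read as a supremum. *)
definition worst_gaussian_complexity ::
    "nat \<Rightarrow> 'a set \<Rightarrow> ('a \<Rightarrow> 'b) set \<Rightarrow> ('b \<Rightarrow> real ^ 'q) set \<Rightarrow> ereal" where
  "worst_gaussian_complexity n X \<H> \<F> =
     (SUP h\<in>\<H>. SUP x\<in>{x :: nat \<Rightarrow> 'a. \<forall>i\<in>{1..n}. x i \<in> X}.
        emp_gaussian_complexity n (\<lambda>i. h (x i)) \<F>)"

end

theory Submission
  imports Defs
begin

text \<open>Write \<open>w\<close> for the Gaussian width of the set of vectors \<open>(h (x i))\<^sub>i\<close> and \<open>W\<close> for the largest width
  of a set \<open>(f (h (x i)))\<^sub>i\<close> with \<open>h\<close> fixed. Composing an \<open>\<eta> / (2 L)\<close>-net of the former with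
  \<open>\<eta> / 2\<close>-nets of the latter gives an \<open>\<eta>\<close>-net of the composed class, and Sudakov's minoration bounds
  the logarithm of its size by a constant times \<open>((L w + W) / \<eta>)\<^sup>2\<close>. Every level of Dudley's chaining
  therefore costs the same multiple of \<open>L w + W\<close>. The class lies in a ball of radius
  \<open>sqrt n * D\<close> and radius \<open>sqrt n * D / n\<^sup>2\<close> is negligible, so \<open>O(log n)\<close> dyadic levels suffice.

  Sudakov's minoration is obtained without Gaussian comparison, by packing translates of a
  symmetric set of Gaussian measure at least \<open>1 / 2\<close> on which all increments are bounded.\<close>

section \<open>Standard Gaussian vectors\<close>

definition gauss :: "'i set \<Rightarrow> ('i \<Rightarrow> real) measure" where
  "gauss I = Pi\<^sub>M I (\<lambda>_. std_normal_distribution)"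

definition dotp :: "'i set \<Rightarrow> ('i \<Rightarrow> real) \<Rightarrow> ('i \<Rightarrow> real) \<Rightarrow> real" where
  "dotp I u v = (\<Sum>i\<in>I. u i * v i)"

lemma prob_space_std_normal: "prob_space std_normal_distribution"
  by (rule prob_space_normal_density) simp

lemma prob_space_gauss: "prob_space (gauss I)"
  unfolding gauss_def by (intro prob_space_PiM prob_space_std_normal)

lemma space_gauss: "space (gauss I) = Pi\<^sub>E I (\<lambda>_. UNIV)"
  by (simp add: gauss_def space_PiM)

lemma sets_gauss [measurable_cong]: "sets (gauss I) = sets (Pi\<^sub>M I (\<lambda>_. borel))"
  unfolding gauss_def by (intro sets_PiM_cong) auto

lemma measurable_dotp [measurable]: "(\<lambda>g. dotp I g v) \<in> borel_measurable (gauss I)"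
  unfolding dotp_def by measurable

lemma dotp_diff_right: "dotp I g (\<lambda>i. u i - v i) = dotp I g u - dotp I g v"
  by (simp add: dotp_def sum_subtractf algebra_simps)

lemma dotp_diff_left: "dotp I (\<lambda>i. u i - v i) g = dotp I u g - dotp I v g"
  by (simp add: dotp_def sum_subtractf algebra_simps)

lemma dotp_scale_right: "dotp I g (\<lambda>i. c * v i) = c * dotp I g v"
  by (simp add: dotp_def sum_distrib_left mult_ac)

lemma dotp_self: "dotp I v v = (L2_set v I)\<^sup>2"
  by (simp add: dotp_def L2_set_def sum_nonneg power2_eq_square)

lemma L2_set_scale: "L2_set (\<lambda>i. c * v i) I = \<bar>c\<bar> * L2_set v I"
  by (simp add: L2_set_def power_mult_distrib real_sqrt_mult flip: sum_distrib_left)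

lemma dotp_le: "dotp I u v \<le> L2_set u I * L2_set v I"
proof -
  have "dotp I u v \<le> (\<Sum>i\<in>I. \<bar>u i\<bar> * \<bar>v i\<bar>)"
    unfolding dotp_def by (intro sum_mono) (metis abs_ge_self abs_mult)
  also have "\<dots> \<le> L2_set u I * L2_set v I"
    by (rule L2_set_mult_ineq)
  finally show ?thesis .
qed

section \<open>Translation and reflection of the Gaussian measure\<close>

text \<open>Completing the square in the exponent: the density at \<open>x - a\<close> is the
  density at \<open>x\<close> times \<open>exp (a * x - a\<^sup>2 / 2)\<close>. This is the
  one-dimensional Cameron-Martin formula.\<close>

lemma nn_integral_std_normal_shift:
  assumes [measurable]: "f \<in> borel_measurable borel"
  shows "(\<integral>\<^sup>+x. f (x + a) \<partial>std_normal_distribution)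
    = (\<integral>\<^sup>+x. f x * ennreal (exp (a * x - a\<^sup>2 / 2)) \<partial>std_normal_distribution)"
proof -
  have *: "std_normal_density (x - a) = std_normal_density x * exp (a * x - a\<^sup>2 / 2)" for x
    by (simp add: std_normal_density_def mult_exp_exp power2_eq_square field_simps)
  have "(\<integral>\<^sup>+x. f (x + a) \<partial>std_normal_distribution)
      = (\<integral>\<^sup>+x. ennreal (std_normal_density x) * f (x + a) \<partial>lborel)"
    by (simp add: nn_integral_density)
  also have "\<dots> = (\<integral>\<^sup>+x. ennreal (std_normal_density (x - a)) * f x \<partial>lborel)"
    by (subst (2) nn_integral_real_affine[where c=1 and t=a]) (auto simp: add_ac)
  also have "\<dots> = (\<integral>\<^sup>+x. ennreal (std_normal_density x) * (f x * ennreal (exp (a * x - a\<^sup>2 / 2))) \<partial>lborel)"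
    by (intro nn_integral_cong) (simp add: * ennreal_mult mult_ac)
  also have "\<dots> = (\<integral>\<^sup>+x. f x * ennreal (exp (a * x - a\<^sup>2 / 2)) \<partial>std_normal_distribution)"
    by (simp add: nn_integral_density)
  finally show ?thesis .
qed

lemma nn_integral_std_normal_uminus:
  assumes [measurable]: "f \<in> borel_measurable borel"
  shows "(\<integral>\<^sup>+x. f (- x) \<partial>std_normal_distribution) = (\<integral>\<^sup>+x. f x \<partial>std_normal_distribution)"
proof -
  have *: "std_normal_density (- x) = std_normal_density x" for x
    by (simp add: std_normal_density_def)
  show ?thesis
    by (simp add: nn_integral_density, subst (2) nn_integral_real_affine[where c="-1" and t=0])
      (auto simp: *)
qed

lemma nn_integral_gauss_prod:
  assumes "finite I" "\<And>i. i \<in> I \<Longrightarrow> f i \<in> borel_measurable borel"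
  shows "(\<integral>\<^sup>+g. (\<Prod>i\<in>I. f i (g i)) \<partial>gauss I) = (\<Prod>i\<in>I. \<integral>\<^sup>+x. f i x \<partial>std_normal_distribution)"
proof -
  interpret product_sigma_finite "\<lambda>_. std_normal_distribution"
    by (simp add: product_sigma_finite_def prob_space_std_normal prob_space_imp_sigma_finite)
  show ?thesis
    unfolding gauss_def by (rule product_nn_integral_prod) (use assms in auto)
qed

lemma indicator_PiE_prod:
  "finite I \<Longrightarrow> g \<in> extensional I \<Longrightarrow>
    (indicator (Pi\<^sub>E I A) g :: ennreal) = (\<Prod>i\<in>I. indicator (A i) (g i))"
  by (auto simp: indicator_def PiE_iff prod_zero_iff intro!: prod.neutral)

text \<open>The standard normal law is even, and the image of a product measure under a
  coordinatewise map is the product of the images.\<close>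

lemma distr_gauss_uminus:
  assumes I: "finite I"
  shows "distr (gauss I) (gauss I) (\<lambda>g. \<lambda>i\<in>I. - g i) = gauss I"
proof -
  have "distr std_normal_distribution std_normal_distribution uminus = std_normal_distribution"
  proof (rule measure_eqI)
    fix A assume "A \<in> sets (distr std_normal_distribution std_normal_distribution uminus)"
    then have [measurable]: "A \<in> sets borel" by simp
    show "emeasure (distr std_normal_distribution std_normal_distribution uminus) A = emeasure std_normal_distribution A"
      using nn_integral_std_normal_uminus[of "indicator A"]
      by (simp add: nn_integral_distr flip: nn_integral_indicator)
  qed simp
  then show ?thesis
    using distr_PiM_finite_prob_space'[OF I, of "\<lambda>_. std_normal_distribution"
        "\<lambda>_. std_normal_distribution" uminus] prob_space_std_normal
    by (simp add: compose_def[abs_def] gauss_def)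
qed

lemma nn_integral_gauss_uminus:
  assumes "finite I" and [measurable]: "F \<in> borel_measurable (gauss I)"
  shows "(\<integral>\<^sup>+g. F (\<lambda>i\<in>I. - g i) \<partial>gauss I) = (\<integral>\<^sup>+g. F g \<partial>gauss I)"
proof -
  have "(\<integral>\<^sup>+g. F g \<partial>distr (gauss I) (gauss I) (\<lambda>g. \<lambda>i\<in>I. - g i)) = (\<integral>\<^sup>+g. F (\<lambda>i\<in>I. - g i) \<partial>gauss I)"
    by (rule nn_integral_distr) measurable
  then show ?thesis
    by (simp add: distr_gauss_uminus[OF assms(1)])
qed

text \<open>The Cameron-Martin theorem in finite dimension. Both measures agree on boxes with the
  product of the shifted one-dimensional laws: the indicator of a box and the exponential weight
  both factor over the coordinates, and the boxes determine a product measure.\<close>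

lemma distr_gauss_shift:
  assumes I: "finite I"
  shows "distr (gauss I) (gauss I) (\<lambda>g. \<lambda>i\<in>I. g i + a i)
    = density (gauss I) (\<lambda>g. ennreal (exp (dotp I g a - (L2_set a I)\<^sup>2 / 2)))"
    (is "?S = ?D")
proof -
  have meas: "(\<lambda>g. \<lambda>i\<in>I. g i + a i) \<in> measurable (gauss I) (gauss I)" by measurable
  let ?N = "\<lambda>i. distr std_normal_distribution borel (\<lambda>x. x + a i)"
  have N: "prob_space (?N i)" for i
    by (intro prob_space.prob_space_distr prob_space_std_normal) auto
  interpret product_sigma_finite ?N
    by (simp add: product_sigma_finite_def N prob_space_imp_sigma_finite)
  have box: "emeasure (?N i) (A i) = (\<integral>\<^sup>+x. indicator (A i) (x + a i) \<partial>std_normal_distribution)"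
    if "A i \<in> sets borel" for A i
    using that by (simp add: nn_integral_distr flip: nn_integral_indicator)
  have eq1: "?S = Pi\<^sub>M I ?N"
  proof (rule PiM_eqI[OF I])
    show "sets ?S = sets (Pi\<^sub>M I ?N)"
      by (simp add: sets_gauss cong: sets_PiM_cong)
    fix A assume A: "\<And>i. i \<in> I \<Longrightarrow> A i \<in> sets (?N i)"
    then have A' [measurable]: "\<And>i. i \<in> I \<Longrightarrow> A i \<in> sets borel" by auto
    have PiE: "Pi\<^sub>E I A \<in> sets (gauss I)"
      unfolding sets_gauss using I A by (intro sets_PiM_I_finite) auto
    have "emeasure ?S (Pi\<^sub>E I A) = (\<integral>\<^sup>+g. indicator (Pi\<^sub>E I A) (\<lambda>i\<in>I. g i + a i) \<partial>gauss I)"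
      using PiE meas by (simp add: nn_integral_distr flip: nn_integral_indicator)
    also have "\<dots> = (\<integral>\<^sup>+g. (\<Prod>i\<in>I. indicator (A i) (g i + a i)) \<partial>gauss I)"
      by (intro nn_integral_cong, subst indicator_PiE_prod[OF I]) (auto intro!: prod.cong)
    also have "\<dots> = (\<Prod>i\<in>I. \<integral>\<^sup>+x. indicator (A i) (x + a i) \<partial>std_normal_distribution)"
      by (rule nn_integral_gauss_prod[OF I]) measurable
    also have "\<dots> = (\<Prod>i\<in>I. emeasure (?N i) (A i))"
      using A' by (intro prod.cong refl box[symmetric]) auto
    finally show "emeasure ?S (Pi\<^sub>E I A) = (\<Prod>i\<in>I. emeasure (?N i) (A i))" .
  qed
  have eq2: "?D = Pi\<^sub>M I ?N"
  proof (rule PiM_eqI[OF I])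
    show "sets ?D = sets (Pi\<^sub>M I ?N)"
      by (simp add: sets_gauss cong: sets_PiM_cong)
    fix A assume A: "\<And>i. i \<in> I \<Longrightarrow> A i \<in> sets (?N i)"
    then have A' [measurable]: "\<And>i. i \<in> I \<Longrightarrow> A i \<in> sets borel" by auto
    have PiE: "Pi\<^sub>E I A \<in> sets (gauss I)"
      unfolding sets_gauss using I A by (intro sets_PiM_I_finite) auto
    have ex: "exp (dotp I g a - (L2_set a I)\<^sup>2 / 2) = (\<Prod>i\<in>I. exp (a i * g i - (a i)\<^sup>2 / 2))" for g
      by (simp add: dotp_def L2_set_def sum_nonneg sum_subtractf sum_divide_distrib mult_ac I flip: exp_sum)
    have "emeasure ?D (Pi\<^sub>E I A)
        = (\<integral>\<^sup>+g. ennreal (exp (dotp I g a - (L2_set a I)\<^sup>2 / 2)) * indicator (Pi\<^sub>E I A) g \<partial>gauss I)"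
      using PiE by (simp add: emeasure_density)
    also have "\<dots> = (\<integral>\<^sup>+g. (\<Prod>i\<in>I. indicator (A i) (g i) * ennreal (exp (a i * g i - (a i)\<^sup>2 / 2))) \<partial>gauss I)"
      by (intro nn_integral_cong, subst indicator_PiE_prod[OF I])
        (auto simp: ex space_gauss PiE_iff prod.distrib prod_ennreal mult_ac)
    also have "\<dots> = (\<Prod>i\<in>I. \<integral>\<^sup>+x. indicator (A i) x * ennreal (exp (a i * x - (a i)\<^sup>2 / 2)) \<partial>std_normal_distribution)"
      by (rule nn_integral_gauss_prod[OF I]) measurable
    also have "\<dots> = (\<Prod>i\<in>I. emeasure (?N i) (A i))"
      using A' by (intro prod.cong refl, subst box, blast, subst nn_integral_std_normal_shift) auto
    finally show "emeasure ?D (Pi\<^sub>E I A) = (\<Prod>i\<in>I. emeasure (?N i) (A i))" .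
  qed
  show ?thesis by (simp only: eq1 eq2)
qed

lemma nn_integral_gauss_shift:
  assumes "finite I" and [measurable]: "F \<in> borel_measurable (gauss I)"
  shows "(\<integral>\<^sup>+g. F (\<lambda>i\<in>I. g i + a i) \<partial>gauss I)
    = (\<integral>\<^sup>+g. F g * ennreal (exp (dotp I g a - (L2_set a I)\<^sup>2 / 2)) \<partial>gauss I)"
proof -
  have "(\<integral>\<^sup>+g. F (\<lambda>i\<in>I. g i + a i) \<partial>gauss I)
      = (\<integral>\<^sup>+g. F g \<partial>distr (gauss I) (gauss I) (\<lambda>g. \<lambda>i\<in>I. g i + a i))"
    by (rule nn_integral_distr[symmetric]) measurable
  also have "\<dots> = (\<integral>\<^sup>+g. F g * ennreal (exp (dotp I g a - (L2_set a I)\<^sup>2 / 2)) \<partial>gauss I)"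
    by (simp add: distr_gauss_shift[OF assms(1)] nn_integral_density mult.commute)
  finally show ?thesis .
qed

section \<open>Exponential and second moments\<close>

text \<open>The weight is the density of a translated Gaussian measure, so it has total mass one;
  the shift formula is applied to the constant function 1.\<close>

lemma gauss_exp:
  assumes I: "finite I"
  shows "integrable (gauss I) (\<lambda>g. exp (dotp I g v - (L2_set v I)\<^sup>2 / 2))"
    and "(\<integral>g. exp (dotp I g v - (L2_set v I)\<^sup>2 / 2) \<partial>gauss I) = 1"
proof -
  interpret prob_space "gauss I" by (rule prob_space_gauss)
  have "(\<integral>\<^sup>+g. ennreal (exp (dotp I g v - (L2_set v I)\<^sup>2 / 2)) \<partial>gauss I) = ennreal 1"
    using nn_integral_gauss_shift[OF I, of "\<lambda>_. 1" v] by (simp add: emeasure_space_1)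
  then have "has_bochner_integral (gauss I) (\<lambda>g. exp (dotp I g v - (L2_set v I)\<^sup>2 / 2)) 1"
    by (intro has_bochner_integral_nn_integral) auto
  then show "integrable (gauss I) (\<lambda>g. exp (dotp I g v - (L2_set v I)\<^sup>2 / 2))"
    and "(\<integral>g. exp (dotp I g v - (L2_set v I)\<^sup>2 / 2) \<partial>gauss I) = 1"
    by (auto simp: has_bochner_integral_iff)
qed

lemma gauss_component:
  assumes "i \<in> I" and [measurable]: "f \<in> borel_measurable borel"
  shows "integrable (gauss I) (\<lambda>g. f (g i) :: real) \<longleftrightarrow> integrable std_normal_distribution f"
    and "(\<integral>g. f (g i) \<partial>gauss I) = (\<integral>x. f x \<partial>std_normal_distribution)"
proof -
  have *: "distr (gauss I) std_normal_distribution (\<lambda>g. g i) = std_normal_distribution"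
    unfolding gauss_def using assms(1) by (intro distr_PiM_component prob_space_std_normal)
  have meas: "(\<lambda>g. g i) \<in> measurable (gauss I) std_normal_distribution"
    using assms(1) by measurable
  show "integrable (gauss I) (\<lambda>g. f (g i) :: real) \<longleftrightarrow> integrable std_normal_distribution f"
    using integrable_distr_eq[OF meas, of f] by (simp add: *)
  show "(\<integral>g. f (g i) \<partial>gauss I) = (\<integral>x. f x \<partial>std_normal_distribution)"
    using integral_distr[OF meas, of f] by (simp add: *)
qed

lemma gauss_component_moments:
  assumes "i \<in> I"
  shows "integrable (gauss I) (\<lambda>g. g i)" "(\<integral>g. g i \<partial>gauss I) = 0"
    "integrable (gauss I) (\<lambda>g. (g i)\<^sup>2)" "(\<integral>g. (g i)\<^sup>2 \<partial>gauss I) = 1"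
  using gauss_component[OF assms, of "\<lambda>x. x"] gauss_component[OF assms, of "\<lambda>x. x\<^sup>2"]
    integrable_std_normal_distribution_moment[of 1] integrable_std_normal_distribution_moment[of 2]
    integral_std_normal_distribution_moment_odd[of 1] std_normal_distribution_even_moments(1)[of 1]
  by simp_all

lemma integrable_dotp [intro, simp]: "integrable (gauss I) (\<lambda>g. dotp I g v)"
  unfolding dotp_def by (intro Bochner_Integration.integrable_sum integrable_mult_left gauss_component_moments)

lemma integral_dotp [simp]: "(\<integral>g. dotp I g v \<partial>gauss I) = 0"
  unfolding dotp_def
  by (subst Bochner_Integration.integral_sum) (auto simp: gauss_component_moments)

lemma gauss_norm_square:
  shows "integrable (gauss I) (\<lambda>g. (L2_set g I)\<^sup>2)" "(\<integral>g. (L2_set g I)\<^sup>2 \<partial>gauss I) = card I"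
  by (auto simp: L2_set_def sum_nonneg gauss_component_moments Bochner_Integration.integral_sum)

section \<open>Gaussian width of finite sets\<close>

text \<open>Applied to finite sets, where the maximum is measurable and integrable. An infinite set
  is controlled by a common bound on the widths of its finite subsets.\<close>

definition gauss_width :: "'i set \<Rightarrow> ('i \<Rightarrow> real) set \<Rightarrow> real" where
  "gauss_width I P = (\<integral>g. (MAX v\<in>P. dotp I g v) \<partial>gauss I)"

lemma integrable_Max_dotp:
  assumes P: "finite P" "P \<noteq> {}"
  shows "integrable (gauss I) (\<lambda>g. MAX v\<in>P. dotp I g v)"
proof (rule Bochner_Integration.integrable_bound)
  show "integrable (gauss I) (\<lambda>g. \<Sum>v\<in>P. \<bar>dotp I g v\<bar>)" by auto
  show "(\<lambda>g. MAX v\<in>P. dotp I g v) \<in> borel_measurable (gauss I)"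
    using P by measurable
  have "\<bar>MAX v\<in>P. dotp I g v\<bar> \<le> (\<Sum>v\<in>P. \<bar>dotp I g v\<bar>)" for g
  proof -
    have "(MAX v\<in>P. dotp I g v) \<in> dotp I g ` P" using P by (intro Max_in) auto
    then obtain v where "v \<in> P" "(MAX v\<in>P. dotp I g v) = dotp I g v" by auto
    then show ?thesis
      using P member_le_sum[of v P "\<lambda>v. \<bar>dotp I g v\<bar>"] by auto
  qed
  then show "AE g in gauss I. norm (MAX v\<in>P. dotp I g v) \<le> norm (\<Sum>v\<in>P. \<bar>dotp I g v\<bar>)"
    by (intro AE_I2) (simp add: sum_nonneg)
qed

lemma gauss_width_nonneg:
  assumes P: "finite P" "P \<noteq> {}"
  shows "0 \<le> gauss_width I P"
proof -
  obtain v where "v \<in> P" using P by auto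
  have "(\<integral>g. dotp I g v \<partial>gauss I) \<le> gauss_width I P"
    unfolding gauss_width_def
    using P \<open>v \<in> P\<close> by (intro integral_mono integrable_Max_dotp integrable_dotp) auto
  then show ?thesis by simp
qed

lemma gauss_width_mono:
  assumes "finite P" "Q \<noteq> {}" "Q \<subseteq> P"
  shows "gauss_width I Q \<le> gauss_width I P"
  unfolding gauss_width_def
  using assms finite_subset[of Q P]
  by (intro integral_mono integrable_Max_dotp Max_mono) auto

lemma gauss_width_uminus:
  assumes I: "finite I" and P: "finite P" "P \<noteq> {}"
  shows "integrable (gauss I) (\<lambda>g. MAX v\<in>P. - dotp I g v)"
    and "(\<integral>g. (MAX v\<in>P. - dotp I g v) \<partial>gauss I) = gauss_width I P"
proof -
  have [measurable]: "(\<lambda>g. MAX v\<in>P. dotp I g v) \<in> borel_measurable (gauss I)"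
    using P by measurable
  have meas: "(\<lambda>g. \<lambda>i\<in>I. - g i) \<in> measurable (gauss I) (gauss I)" by measurable
  have *: "dotp I (\<lambda>i\<in>I. - g i) v = - dotp I g v" for g v
    by (simp add: dotp_def sum_negf)
  show "integrable (gauss I) (\<lambda>g. MAX v\<in>P. - dotp I g v)"
    using integrable_distr_eq[OF meas, of "\<lambda>g. MAX v\<in>P. dotp I g v"] integrable_Max_dotp[OF P]
    by (simp add: distr_gauss_uminus[OF I] *)
  show "(\<integral>g. (MAX v\<in>P. - dotp I g v) \<partial>gauss I) = gauss_width I P"
    using integral_distr[OF meas, of "\<lambda>g. MAX v\<in>P. dotp I g v"]
    by (simp add: distr_gauss_uminus[OF I] * gauss_width_def)
qed

text \<open>For symmetric \<open>E\<close> the Cameron-Martin weight may be averaged over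
  \<open>g\<close> and \<open>-g\<close>. The average is
  \<open>exp (- (L2_set a I)\<^sup>2 / 2)\<close> times a hyperbolic cosine, which is at least
  1.\<close>

lemma gauss_shift_symmetric:
  assumes I: "finite I" and E [measurable]: "E \<in> sets (gauss I)"
    and sym: "\<And>g. g \<in> space (gauss I) \<Longrightarrow> (\<lambda>i\<in>I. - g i) \<in> E \<longleftrightarrow> g \<in> E"
  shows "exp (- (L2_set a I)\<^sup>2 / 2) * measure (gauss I) E
    \<le> measure (gauss I) {g \<in> space (gauss I). (\<lambda>i\<in>I. g i + a i) \<in> E}"
proof -
  interpret prob_space "gauss I" by (rule prob_space_gauss)
  let ?n = "(L2_set a I)\<^sup>2 / 2"
  define A where "A = {g \<in> space (gauss I). (\<lambda>i\<in>I. g i + a i) \<in> E}"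
  have A [measurable]: "A \<in> sets (gauss I)" unfolding A_def by measurable
  have e1: "emeasure (gauss I) A = (\<integral>\<^sup>+g. indicator E g * ennreal (exp (dotp I g a - ?n)) \<partial>gauss I)"
  proof -
    have "emeasure (gauss I) A = (\<integral>\<^sup>+g. indicator E (\<lambda>i\<in>I. g i + a i) \<partial>gauss I)"
      unfolding nn_integral_indicator[OF A, symmetric]
      by (intro nn_integral_cong) (auto simp: A_def indicator_def)
    also have "\<dots> = (\<integral>\<^sup>+g. indicator E g * ennreal (exp (dotp I g a - ?n)) \<partial>gauss I)"
      by (rule nn_integral_gauss_shift[OF I]) measurable
    finally show ?thesis .
  qed
  \<comment> \<open>The same measure after reflecting \<open>g\<close>: \<open>E\<close> is
    unchanged and the linear term of the exponent changes sign.\<close>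
  have e2: "emeasure (gauss I) A = (\<integral>\<^sup>+g. indicator E g * ennreal (exp (- dotp I g a - ?n)) \<partial>gauss I)"
    unfolding e1
    by (subst nn_integral_gauss_uminus[OF I, symmetric], measurable, intro nn_integral_cong)
       (auto simp: indicator_def sym dotp_def sum_negf)
  have "2 * (ennreal (exp (- ?n)) * emeasure (gauss I) E)
      = (\<integral>\<^sup>+g. 2 * (ennreal (exp (- ?n)) * indicator E g) \<partial>gauss I)"
    by (simp add: nn_integral_cmult)
  also have "\<dots> \<le> (\<integral>\<^sup>+g. indicator E g * ennreal (exp (dotp I g a - ?n))
        + indicator E g * ennreal (exp (- dotp I g a - ?n)) \<partial>gauss I)"
  proof (intro nn_integral_mono)
    fix g
    have "2 * exp (- ?n) \<le> exp (dotp I g a - ?n) + exp (- dotp I g a - ?n)"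
    proof -
      have "2 \<le> exp (dotp I g a) + exp (- dotp I g a)"
        using cosh_real_ge_1[of "dotp I g a"] by (simp add: cosh_def)
      then have "2 * exp (- ?n) \<le> (exp (dotp I g a) + exp (- dotp I g a)) * exp (- ?n)"
        by (intro mult_right_mono) auto
      then show ?thesis by (simp add: distrib_right mult_exp_exp)
    qed
    then have "ennreal (2 * exp (- ?n)) \<le> ennreal (exp (dotp I g a - ?n) + exp (- dotp I g a - ?n))"
      by (rule ennreal_leI)
    then show "2 * (ennreal (exp (- ?n)) * indicator E g) \<le> indicator E g * ennreal (exp (dotp I g a - ?n))
        + indicator E g * ennreal (exp (- dotp I g a - ?n))"
      by (auto simp: indicator_def ennreal_mult)
  qed
  also have "\<dots> = emeasure (gauss I) A + emeasure (gauss I) A"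
    by (subst nn_integral_add) (auto simp: e1[symmetric] e2[symmetric])
  finally have "2 * (ennreal (exp (- ?n)) * emeasure (gauss I) E) \<le> 2 * emeasure (gauss I) A"
    by (simp add: mult_2)
  then have "ennreal (2 * (exp (- ?n) * measure (gauss I) E)) \<le> ennreal (2 * measure (gauss I) A)"
    by (simp add: emeasure_eq_measure ennreal_mult)
  then have "2 * (exp (- ?n) * measure (gauss I) E) \<le> 2 * measure (gauss I) A"
    by (subst (asm) ennreal_le_iff) auto
  then show ?thesis by (simp add: A_def)
qed

text \<open>Markov's inequality for the oscillation of \<open>dotp I g\<close> over
  \<open>P\<close>. It is the maximum of \<open>dotp I g v\<close> plus the maximum of
  \<open>- dotp I g v\<close>, and by symmetry both have mean
  \<open>gauss_width I P\<close>.\<close>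

lemma gauss_width_markov:
  assumes I: "finite I" and P: "finite P" "P \<noteq> {}" and M: "0 < M"
  shows "1 - 2 * gauss_width I P / M
    \<le> measure (gauss I) {g \<in> space (gauss I). \<forall>u\<in>P. \<forall>v\<in>P. dotp I g u - dotp I g v < M}"
proof -
  interpret prob_space "gauss I" by (rule prob_space_gauss)
  define E where "E = {g \<in> space (gauss I). \<forall>u\<in>P. \<forall>v\<in>P. dotp I g u - dotp I g v < M}"
  have [measurable]: "E \<in> sets (gauss I)" unfolding E_def using P by measurable
  define X where "X = (\<lambda>g. (MAX v\<in>P. dotp I g v) + (MAX v\<in>P. - dotp I g v))"
  have ge: "dotp I g u - dotp I g v \<le> X g" if "u \<in> P" "v \<in> P" for g u v
  proof -
    have "dotp I g u \<le> (MAX v\<in>P. dotp I g v)" "- dotp I g v \<le> (MAX v\<in>P. - dotp I g v)"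
      using P that by (auto intro!: Max_ge)
    then show ?thesis by (simp add: X_def)
  qed
  have X: "integrable (gauss I) X" "(\<integral>g. X g \<partial>gauss I) = 2 * gauss_width I P"
    unfolding X_def using gauss_width_uminus[OF I P] integrable_Max_dotp[OF P]
    by (auto simp: gauss_width_def)
  have nn: "0 \<le> X g" for g
    using P(2) ge[of _ _ g] by fastforce
  have "prob {g \<in> space (gauss I). X g \<ge> M} \<le> (\<integral>g. X g \<partial>gauss I) / M"
    by (rule integral_Markov_inequality_measure[where A="{}"]) (use X M nn in auto)
  moreover have "1 - prob E \<le> prob {g \<in> space (gauss I). X g \<ge> M}"
  proof -
    have "1 - prob E = prob (space (gauss I) - E)" by (simp add: prob_compl)
    also have "\<dots> \<le> prob {g \<in> space (gauss I). X g \<ge> M}"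
      using X(1) ge by (intro finite_measure_mono) (auto simp: E_def not_less intro: order_trans)
    finally show ?thesis .
  qed
  ultimately show ?thesis using X(2) by (simp add: E_def)
qed

section \<open>Sudakov's minoration\<close>

text \<open>Euclidean distance on the coordinates in \<open>I\<close>. On functions this is only a
  pseudometric, since distinct functions may agree on \<open>I\<close>; positive separation excludes
  such pairs.\<close>

definition ldist :: "'i set \<Rightarrow> ('i \<Rightarrow> real) \<Rightarrow> ('i \<Rightarrow> real) \<Rightarrow> real" where
  "ldist I u v = L2_set (\<lambda>i. u i - v i) I"

lemma ldist_nonneg [simp]: "0 \<le> ldist I u v"
  by (simp add: ldist_def)

lemma ldist_commute: "ldist I u v = ldist I v u"
  unfolding ldist_def L2_set_def by (intro arg_cong[where f=sqrt] sum.cong) (simp_all add: power2_commute)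

lemma ldist_self [simp]: "ldist I u u = 0"
  by (simp add: ldist_def L2_set_def)

lemma ldist_triangle: "ldist I u w \<le> ldist I u v + ldist I v w"
  using L2_set_triangle_ineq[of "\<lambda>i. u i - v i" "\<lambda>i. v i - w i" I] by (simp add: ldist_def)

definition separated :: "'i set \<Rightarrow> real \<Rightarrow> ('i \<Rightarrow> real) set \<Rightarrow> bool" where
  "separated I \<epsilon> P \<longleftrightarrow> (\<forall>u\<in>P. \<forall>v\<in>P. u \<noteq> v \<longrightarrow> \<epsilon> \<le> ldist I u v)"

lemma separated_subset: "separated I \<epsilon> P \<Longrightarrow> Q \<subseteq> P \<Longrightarrow> separated I \<epsilon> Q"
  by (auto simp: separated_def)

text \<open>The translates \<open>c (u - a) + E\<close> of the symmetric set \<open>E = {g. \<forall>u v. \<langle>g, u - v\<rangle> < M}\<close> are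
  disjoint once \<open>c \<epsilon>\<^sup>2 \<ge> 2 M\<close>, while each keeps at least the fraction
  \<open>exp (- c\<^sup>2 R\<^sup>2 / 2)\<close> of the Gaussian measure of \<open>E\<close>.\<close>

lemma card_separated_ball:
  assumes I: "finite I" and P: "finite P" "P \<noteq> {}" and M: "0 < M" and \<epsilon>: "0 < \<epsilon>"
    and sep: "separated I \<epsilon> P" and ball: "\<And>u. u \<in> P \<Longrightarrow> ldist I u a \<le> R"
    and p: "0 \<le> p" "2 * gauss_width I P \<le> (1 - p) * M"
  shows "p * card P \<le> exp (2 * M\<^sup>2 * R\<^sup>2 / \<epsilon> ^ 4)"
proof -
  interpret prob_space "gauss I" by (rule prob_space_gauss)
  define E where "E = {g \<in> space (gauss I). \<forall>u\<in>P. \<forall>v\<in>P. dotp I g u - dotp I g v < M}"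
  have E [measurable]: "E \<in> sets (gauss I)" unfolding E_def using P by measurable
  have "2 * gauss_width I P / M \<le> 1 - p"
    using p M by (simp add: field_simps)
  then have pE: "p \<le> prob E"
    using gauss_width_markov[OF I P M] unfolding E_def by linarith
  have sym: "(\<lambda>i\<in>I. - g i) \<in> E \<longleftrightarrow> g \<in> E" if "g \<in> space (gauss I)" for g
  proof -
    have "dotp I (\<lambda>i\<in>I. - g i) v = - dotp I g v" for v
      by (simp add: dotp_def sum_negf)
    then show ?thesis
      using that by (auto simp: E_def space_gauss algebra_simps)
  qed
  define c where "c = 2 * M / \<epsilon>\<^sup>2"
  have c: "0 < c" "c * \<epsilon>\<^sup>2 = 2 * M" using M \<epsilon> by (auto simp: c_def)
  \<comment> \<open>The minus sign makes \<open>A u\<close> the translate of \<open>E\<close> by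
    \<open>c * (u - a)\<close>.\<close>
  define b where "b = (\<lambda>u i. - c * (u i - a i))"
  define A where "A = (\<lambda>u. {g \<in> space (gauss I). (\<lambda>i\<in>I. g i + b u i) \<in> E})"
  have A [measurable]: "A u \<in> sets (gauss I)" for u unfolding A_def by measurable
  have disj: "disjoint_family_on A P"
  proof (rule ccontr)
    assume "\<not> disjoint_family_on A P"
    then obtain u v g where uv: "u \<in> P" "v \<in> P" "u \<noteq> v" and g: "g \<in> A u" "g \<in> A v"
      by (auto simp: disjoint_family_on_def)
    have *: "dotp I (\<lambda>i\<in>I. g i + b u i) w = dotp I g w - c * (dotp I u w - dotp I a w)" for u w
      by (simp add: dotp_def b_def algebra_simps sum.distrib sum_subtractf sum_distrib_left)
    \<comment> \<open>A common point \<open>g\<close> is tested against the pair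
      \<open>(v, u)\<close> in the translate of \<open>u\<close> and against \<open>(u, v)\<close>
      in that of \<open>v\<close>. In the sum both \<open>g\<close> and the centre \<open>a\<close>
      cancel, leaving \<open>c\<close> times the squared distance.\<close>
    have "dotp I (\<lambda>i\<in>I. g i + b u i) v - dotp I (\<lambda>i\<in>I. g i + b u i) u < M"
         "dotp I (\<lambda>i\<in>I. g i + b v i) u - dotp I (\<lambda>i\<in>I. g i + b v i) v < M"
      using g uv by (auto simp: A_def E_def)
    then have "c * (dotp I u u - dotp I u v - dotp I v u + dotp I v v) < 2 * M"
      unfolding * by (simp add: algebra_simps)
    also have "dotp I u u - dotp I u v - dotp I v u + dotp I v v = (ldist I u v)\<^sup>2"
      unfolding ldist_def dotp_self[symmetric] by (simp add: dotp_diff_left dotp_diff_right)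
    finally have "c * (ldist I u v)\<^sup>2 < 2 * M" .
    moreover have "c * \<epsilon>\<^sup>2 \<le> c * (ldist I u v)\<^sup>2"
      using sep uv c \<epsilon> by (intro mult_left_mono power_mono) (auto simp: separated_def)
    ultimately show False using c by simp
  qed
  define q where "q = exp (- (c\<^sup>2 * R\<^sup>2) / 2)"
  have "p * q \<le> prob (A u)" if u: "u \<in> P" for u
  proof -
    have "L2_set (b u) I = c * ldist I u a"
      unfolding b_def L2_set_scale ldist_def using c by simp
    then have "(L2_set (b u) I)\<^sup>2 \<le> (c * R)\<^sup>2"
      using ball[OF u] c by (intro power_mono) (auto intro: mult_left_mono)
    then have "q \<le> exp (- (L2_set (b u) I)\<^sup>2 / 2)"
      by (simp add: q_def power_mult_distrib)
    then have "q * p \<le> exp (- (L2_set (b u) I)\<^sup>2 / 2) * prob E"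
      using pE p by (intro mult_mono) auto
    also have "\<dots> \<le> prob (A u)"
      unfolding A_def by (rule gauss_shift_symmetric[OF I E sym])
    finally show ?thesis by (simp add: mult.commute)
  qed
  then have "(\<Sum>u\<in>P. p * q) \<le> (\<Sum>u\<in>P. prob (A u))" by (rule sum_mono)
  also have "\<dots> = prob (\<Union>u\<in>P. A u)"
    using P disj by (intro finite_measure_finite_Union[symmetric]) auto
  also have "\<dots> \<le> 1" by simp
  finally have "p * card P * q \<le> 1" by (simp add: mult_ac)
  then have "p * card P * q * exp (c\<^sup>2 * R\<^sup>2 / 2) \<le> exp (c\<^sup>2 * R\<^sup>2 / 2)"
    by (simp add: mult_le_cancel_right1)
  moreover have "q * exp (c\<^sup>2 * R\<^sup>2 / 2) = 1"
    by (simp add: q_def mult_exp_exp)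
  moreover have "c\<^sup>2 * R\<^sup>2 / 2 = 2 * M\<^sup>2 * R\<^sup>2 / \<epsilon> ^ 4"
    using \<epsilon> by (simp add: c_def power_divide power_mult_distrib flip: power_mult)
  ultimately show ?thesis by (metis mult.assoc mult.right_neutral)
qed

text \<open>Two points form a separated set in a ball around their midpoint, of radius half their
  distance, so too small a width contradicts \<open>card_separated_ball\<close>. The resulting lower
  bound on the width serves to absorb multiplicative constants into exponents.\<close>

lemma gauss_width_pair:
  assumes I: "finite I" and P: "finite P" "u \<in> P" "v \<in> P" and sep: "0 < ldist I u v"
  shows "ldist I u v < 10 * gauss_width I P"
proof (rule ccontr)
  define \<epsilon> where "\<epsilon> = ldist I u v"
  define m where "m = (\<lambda>i. (u i + v i) / 2)"
  assume "\<not> ldist I u v < 10 * gauss_width I P"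
  then have W: "10 * gauss_width I P \<le> \<epsilon>" by (simp add: \<epsilon>_def)
  have ne: "u \<noteq> v" using sep by auto
  have m: "ldist I u m = \<epsilon> / 2" "ldist I v m = \<epsilon> / 2"
  proof -
    have "(\<lambda>i. u i - m i) = (\<lambda>i. 1/2 * (u i - v i))" "(\<lambda>i. v i - m i) = (\<lambda>i. -1/2 * (u i - v i))"
      by (auto simp: m_def field_simps)
    then show "ldist I u m = \<epsilon> / 2" "ldist I v m = \<epsilon> / 2"
      unfolding \<epsilon>_def ldist_def by (simp_all only: L2_set_scale)
  qed
  have "gauss_width I {u, v} \<le> gauss_width I P"
    using P by (intro gauss_width_mono) auto
  \<comment> \<open>The choice is \<open>M = 8/10 * \<epsilon>\<close> and \<open>p = 3/4\<close>,
    for which \<open>(1 - p) * M\<close> is exactly \<open>2 * \<epsilon> / 10\<close>. The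
    contradiction is that 3/2 exceeds \<open>exp (8 / 25)\<close>.\<close>
  then have "3/4 * card {u, v} \<le> exp (2 * (8/10 * \<epsilon>)\<^sup>2 * (\<epsilon> / 2)\<^sup>2 / \<epsilon> ^ 4)"
    using sep W m gauss_width_nonneg[OF P(1), of I] P
    by (intro card_separated_ball[OF I, where a=m])
       (auto simp: separated_def \<epsilon>_def[symmetric] ldist_commute[of I v u])
  also have "2 * (8/10 * \<epsilon>)\<^sup>2 * (\<epsilon> / 2)\<^sup>2 / \<epsilon> ^ 4 = 8 / 25"
    using sep by (simp add: \<epsilon>_def power_divide power_mult_distrib field_simps flip: power_add)
  also have "exp (8 / 25 :: real) \<le> 1 + 8/25 + (8/25)\<^sup>2"
    by (rule exp_bound) auto
  finally show False using ne by (simp add: power2_eq_square)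
qed

text \<open>With \<open>W\<close> the width of \<open>P\<close>, \<open>card_separated_ball\<close>
  for \<open>M = 4 * W\<close> and \<open>p = 1/2\<close> gives
  \<open>2 * exp (128 * (W / \<epsilon>)\<^sup>2)\<close>. Two distinct points force
  \<open>\<epsilon> < 10 * W\<close>, so the factor 2 costs at most 100 more in the exponent. The
  constant 243 is three quarters of \<open>18\<^sup>2\<close>, the share that \<open>sudakov\<close>
  allots to the local bound.\<close>

lemma card_separated_local:
  assumes I: "finite I" and P: "finite P" "P \<noteq> {}" and \<epsilon>: "0 < \<epsilon>"
    and sep: "separated I \<epsilon> P" and ball: "\<And>u. u \<in> P \<Longrightarrow> ldist I u a \<le> 2 * \<epsilon>"
  shows "card P \<le> exp (243 * (gauss_width I P / \<epsilon>)\<^sup>2)"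
proof (cases "\<exists>u\<in>P. \<exists>v\<in>P. u \<noteq> v")
  case False
  then have "\<exists>u. P = {u}" using P by blast
  then show ?thesis by auto
next
  case True
  then obtain u v where uv: "u \<in> P" "v \<in> P" "u \<noteq> v" by blast
  define W where "W = gauss_width I P"
  have "\<epsilon> \<le> ldist I u v" using sep uv by (auto simp: separated_def)
  then have W: "\<epsilon> < 10 * W"
    using gauss_width_pair[OF I P(1) uv(1,2)] \<epsilon> by (simp add: W_def)
  have "1/2 * card P \<le> exp (2 * (4 * W)\<^sup>2 * (2 * \<epsilon>)\<^sup>2 / \<epsilon> ^ 4)"
    using W \<epsilon> by (intro card_separated_ball[OF I P _ \<epsilon> sep ball]) (auto simp: W_def)
  also have "2 * (4 * W)\<^sup>2 * (2 * \<epsilon>)\<^sup>2 / \<epsilon> ^ 4 = 128 * (W / \<epsilon>)\<^sup>2"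
    using \<epsilon> by (simp add: power_divide power_mult_distrib field_simps flip: power_add)
  finally have 1: "card P \<le> 2 * exp (128 * (W / \<epsilon>)\<^sup>2)" by simp
  have "1 \<le> (10 * (W / \<epsilon>))\<^sup>2"
    using W \<epsilon> by (intro one_le_power) simp
  then have "1 \<le> 100 * (W / \<epsilon>)\<^sup>2" by (simp only: power_mult_distrib) simp
  then have "2 \<le> exp (100 * (W / \<epsilon>)\<^sup>2)"
    using exp_ge_add_one_self[of "100 * (W / \<epsilon>)\<^sup>2"] by linarith
  then have "2 * exp (128 * (W / \<epsilon>)\<^sup>2) \<le> exp (100 * (W / \<epsilon>)\<^sup>2) * exp (128 * (W / \<epsilon>)\<^sup>2)"
    by (intro mult_right_mono) auto
  also have "\<dots> \<le> exp (243 * (W / \<epsilon>)\<^sup>2)" by (simp add: mult_exp_exp)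
  finally show ?thesis using 1 by (simp add: W_def)
qed

text \<open>In a separated subset of largest cardinality no further point can be added, so every
  point of \<open>T\<close> is close to it. The alternative \<open>t = q\<close> covers the case of
  nonpositive \<open>\<epsilon>\<close>.\<close>

lemma maximal_separated:
  assumes bound: "\<And>P. finite P \<Longrightarrow> P \<subseteq> T \<Longrightarrow> separated I \<epsilon> P \<Longrightarrow> card P \<le> (N::nat)"
  obtains Q where "finite Q" "Q \<subseteq> T" "separated I \<epsilon> Q" "\<And>t. t \<in> T \<Longrightarrow> \<exists>q\<in>Q. ldist I t q < \<epsilon> \<or> t = q"
proof -
  let ?S = "{P. finite P \<and> P \<subseteq> T \<and> separated I \<epsilon> P}"
  have S: "{} \<in> ?S" by (auto simp: separated_def)
  have "\<forall>P. P \<in> ?S \<longrightarrow> card P < Suc N" using bound by (auto simp: less_Suc_eq_le)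
  then have "\<exists>Q. Q \<in> ?S \<and> (\<forall>P. P \<in> ?S \<longrightarrow> card P \<le> card Q)"
    by (rule ex_has_greatest_nat[where P="\<lambda>P. P \<in> ?S", OF S])
  then obtain Q where Q: "finite Q" "Q \<subseteq> T" "separated I \<epsilon> Q"
    and max: "\<And>P. finite P \<Longrightarrow> P \<subseteq> T \<Longrightarrow> separated I \<epsilon> P \<Longrightarrow> card P \<le> card Q" by auto
  have "\<exists>q\<in>Q. ldist I t q < \<epsilon> \<or> t = q" if t: "t \<in> T" for t
  proof (rule ccontr)
    assume c: "\<not> (\<exists>q\<in>Q. ldist I t q < \<epsilon> \<or> t = q)"
    then have "separated I \<epsilon> (insert t Q)"
      using Q(3) by (auto simp: separated_def not_less ldist_commute[of I _ t])
    then have "card (insert t Q) \<le> card Q" using Q t by (intro max) auto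
    moreover have "t \<notin> Q" using c by auto
    ultimately show False using Q(1) by simp
  qed
  with Q that show thesis by blast
qed

text \<open>Localisation costs nothing: a maximal \<open>2 \<epsilon>\<close>-separated subset has, by
  induction, log-cardinality at most a quarter of the claimed bound, and the local bound accounts
  for the remaining three quarters.\<close>

lemma sudakov:
  assumes I: "finite I" and "finite P" "P \<noteq> {}" "0 < \<epsilon>" "separated I \<epsilon> P"
  shows "card P \<le> exp ((18 * gauss_width I P / \<epsilon>)\<^sup>2)"
  using assms(2-)
proof (induction "card P" arbitrary: P \<epsilon> rule: less_induct)
  case less
  define W where "W = gauss_width I P"
  show ?case
  proof (cases "\<exists>u\<in>P. \<exists>v\<in>P. u \<noteq> v")
    case False
    then have "\<exists>u. P = {u}" using less.prems by blast
    then show ?thesis by auto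
  next
    case True
    let ?D = "(\<lambda>(u, v). ldist I u v) ` {(u, v) \<in> P \<times> P. u \<noteq> v}"
    have fin: "finite ?D"
      using less.prems by (auto intro: finite_subset[of _ "P \<times> P"])
    have ne: "?D \<noteq> {}" using True by auto
    \<comment> \<open>Passing to the minimal distance \<open>\<delta>\<close> of \<open>P\<close>
      makes the induction descend: a pair at distance \<open>\<delta>\<close> cannot lie in a
      \<open>2 * \<delta>\<close>-separated set, so \<open>Q\<close> below is a proper subset of
      \<open>P\<close>. As \<open>\<epsilon> \<le> \<delta>\<close>, the bound at scale
      \<open>\<delta>\<close> is the stronger one.\<close>
    define \<delta> where "\<delta> = Min ?D"
    have "\<delta> \<in> ?D" unfolding \<delta>_def using fin ne by (rule Min_in)
    then obtain u v where uv: "u \<in> P" "v \<in> P" "u \<noteq> v" "ldist I u v = \<delta>" by auto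
    have \<delta>: "\<epsilon> \<le> \<delta>" using less.prems uv by (auto simp: separated_def)
    then have pos: "0 < \<delta>" using less.prems by simp
    have sep: "separated I \<delta> P"
      unfolding separated_def \<delta>_def using fin by (auto intro!: Min_le)
    obtain Q where Q: "finite Q" "Q \<subseteq> P" "separated I (2 * \<delta>) Q"
      and cov: "\<And>t. t \<in> P \<Longrightarrow> \<exists>q\<in>Q. ldist I t q < 2 * \<delta> \<or> t = q"
      by (rule maximal_separated[of P I "2 * \<delta>" "card P"]) (use less.prems in \<open>auto intro: card_mono\<close>)
    have Qne: "Q \<noteq> {}" using cov less.prems by blast
    have "Q \<noteq> P"
    proof
      assume "Q = P"
      then have "2 * \<delta> \<le> ldist I u v" using Q(3) uv(1-3) unfolding separated_def by blast
      then show False using uv(4) pos by linarith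
    qed
    then have "card Q < card P" using Q(2) less.prems by (intro psubset_card_mono) auto
    then have "card Q \<le> exp ((18 * gauss_width I Q / (2 * \<delta>))\<^sup>2)"
      using Q Qne pos by (intro less.hyps) auto
    also have "\<dots> \<le> exp ((18 * W / (2 * \<delta>))\<^sup>2)"
      unfolding W_def using less.prems Q Qne pos
      by (auto intro!: power_mono divide_right_mono mult_left_mono gauss_width_mono gauss_width_nonneg
          divide_nonneg_nonneg mult_nonneg_nonneg)
    finally have cQ: "card Q \<le> exp (81 * (W / \<delta>)\<^sup>2)"
      by (simp add: power_divide power_mult_distrib)
    define B where "B = (\<lambda>q. {t \<in> P. ldist I t q < 2 * \<delta> \<or> t = q})"
    have cB: "card (B q) \<le> exp (243 * (W / \<delta>)\<^sup>2)" if q: "q \<in> Q" for q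
    proof -
      have B: "finite (B q)" "B q \<noteq> {}" "B q \<subseteq> P"
        using less.prems Q q by (auto simp: B_def)
      have "card (B q) \<le> exp (243 * (gauss_width I (B q) / \<delta>)\<^sup>2)"
      proof (rule card_separated_local[OF I B(1,2) pos])
        show "separated I \<delta> (B q)" using sep B(3) by (rule separated_subset)
        show "ldist I u q \<le> 2 * \<delta>" if "u \<in> B q" for u
          using that pos by (auto simp: B_def)
      qed
      also have "\<dots> \<le> exp (243 * (W / \<delta>)\<^sup>2)"
        unfolding W_def using less.prems B pos
        by (auto intro!: power_mono divide_right_mono gauss_width_mono gauss_width_nonneg divide_nonneg_nonneg)
      finally show ?thesis .
    qed
    have "P = (\<Union>q\<in>Q. B q)" using cov Q(2) by (auto simp: B_def)
    then have "real (card P) \<le> real (\<Sum>q\<in>Q. card (B q))"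
      using card_UN_le[OF Q(1), of B] by (metis of_nat_le_iff)
    also have "\<dots> \<le> (\<Sum>q\<in>Q. exp (243 * (W / \<delta>)\<^sup>2))"
      unfolding of_nat_sum by (intro sum_mono cB)
    also have "\<dots> = card Q * exp (243 * (W / \<delta>)\<^sup>2)" by simp
    also have "\<dots> \<le> exp (81 * (W / \<delta>)\<^sup>2) * exp (243 * (W / \<delta>)\<^sup>2)"
      by (intro mult_right_mono cQ) auto
    also have "\<dots> = exp ((18 * W / \<delta>)\<^sup>2)"
      by (simp add: mult_exp_exp power_mult_distrib power_divide)
    also have "\<dots> \<le> exp ((18 * W / \<epsilon>)\<^sup>2)"
      unfolding W_def using less.prems \<delta> pos
      by (auto intro!: power_mono divide_left_mono gauss_width_nonneg divide_nonneg_nonneg mult_nonneg_nonneg)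
    finally show ?thesis by (simp add: W_def)
  qed
qed

text \<open>Sudakov's bound holds uniformly for all finite separated subsets of \<open>T\<close>.
  Hence a maximal one exists, and by maximality it is a net.\<close>

lemma sudakov_net:
  assumes I: "finite I" and \<epsilon>: "0 < \<epsilon>" and T: "T \<noteq> {}"
    and W: "\<And>P. finite P \<Longrightarrow> P \<noteq> {} \<Longrightarrow> P \<subseteq> T \<Longrightarrow> gauss_width I P \<le> W"
  obtains Q where "finite Q" "Q \<noteq> {}" "Q \<subseteq> T" "\<And>t. t \<in> T \<Longrightarrow> \<exists>q\<in>Q. ldist I t q \<le> \<epsilon>"
    "card Q \<le> exp ((18 * W / \<epsilon>)\<^sup>2)"
proof -
  have bound: "card P \<le> exp ((18 * W / \<epsilon>)\<^sup>2)" if P: "finite P" "P \<subseteq> T" "separated I \<epsilon> P" for P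
  proof (cases "P = {}")
    case False
    have "card P \<le> exp ((18 * gauss_width I P / \<epsilon>)\<^sup>2)"
      using I P False \<epsilon> by (intro sudakov)
    also have "\<dots> \<le> exp ((18 * W / \<epsilon>)\<^sup>2)"
      using P False \<epsilon> W[OF P(1) False P(2)]
      by (auto intro!: power_mono divide_right_mono gauss_width_nonneg divide_nonneg_nonneg mult_nonneg_nonneg)
    finally show ?thesis .
  qed simp
  obtain Q where Q: "finite Q" "Q \<subseteq> T" "separated I \<epsilon> Q"
    and cov: "\<And>t. t \<in> T \<Longrightarrow> \<exists>q\<in>Q. ldist I t q < \<epsilon> \<or> t = q"
    by (rule maximal_separated[of T I \<epsilon> "nat \<lfloor>exp ((18 * W / \<epsilon>)\<^sup>2)\<rfloor>"])
      (use bound in \<open>auto simp: le_nat_floor\<close>)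
  show thesis
  proof
    show "\<exists>q\<in>Q. ldist I t q \<le> \<epsilon>" if "t \<in> T" for t
      using cov[OF that] \<epsilon> by (metis ldist_self less_imp_le)
    show "Q \<noteq> {}" using cov T by blast
  qed (use Q bound in auto)
qed

section \<open>Chaining\<close>

text \<open>An integrable majorant stands in for the expected supremum: it needs no measurability of
  suprema over infinite families.\<close>

lemma gauss_finite_majorant:
  assumes I: "finite I" and V: "finite V" "\<And>v. v \<in> V \<Longrightarrow> L2_set v I \<le> \<sigma>" "card V \<le> exp (b\<^sup>2)"
    and pos: "0 < \<sigma>" "0 < b"
  obtains B where "integrable (gauss I) B" "\<And>g v. v \<in> V \<Longrightarrow> dotp I g v \<le> B g"
    "(\<integral>g. B g \<partial>gauss I) \<le> 17/12 * b * \<sigma>"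
proof -
  interpret prob_space "gauss I" by (rule prob_space_gauss)
  \<comment> \<open>Slope \<open>l\<close> costs
    \<open>(l * \<sigma>)\<^sup>2 / 2 = 9/8 * b\<^sup>2\<close> in the exponential moment, and the
    cardinality costs \<open>b\<^sup>2\<close>; their sum is \<open>c\<close>. The factor 3/2 is a
    rational stand-in for the optimal square root of 2.\<close>
  define l where "l = 3/2 * b / \<sigma>"
  define c where "c = 17/8 * b\<^sup>2"
  have l: "0 < l" "l * \<sigma> = 3/2 * b" using pos by (auto simp: l_def)
  define e where "e = (\<lambda>v g. exp (l * dotp I g v - c))"
  have e: "integrable (gauss I) (e v)" "(\<integral>g. e v g \<partial>gauss I) \<le> exp (- b\<^sup>2)" if v: "v \<in> V" for v
  proof -
    define w where "w = (\<lambda>i. l * v i)"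
    have eq: "e v g = exp ((L2_set w I)\<^sup>2 / 2 - c) * exp (dotp I g w - (L2_set w I)\<^sup>2 / 2)" for g
      by (simp add: e_def w_def dotp_scale_right mult_exp_exp)
    show "integrable (gauss I) (e v)"
      using gauss_exp[OF I, of w] by (simp add: eq[abs_def])
    have "L2_set w I \<le> 3/2 * b"
      using V(2)[OF v] l unfolding w_def L2_set_scale l(2)[symmetric]
      by (auto intro!: mult_left_mono)
    then have "(L2_set w I)\<^sup>2 \<le> (3/2 * b)\<^sup>2" by (intro power_mono) auto
    then have "(L2_set w I)\<^sup>2 / 2 - c \<le> - b\<^sup>2"
      by (simp add: c_def power_mult_distrib power_divide)
    then show "(\<integral>g. e v g \<partial>gauss I) \<le> exp (- b\<^sup>2)"
      using gauss_exp[OF I, of w] by (simp add: eq)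
  qed
  \<comment> \<open>A linearised soft maximum: \<open>exp y \<ge> 1 + y\<close> at
    \<open>y = l * dotp I g v - c\<close> bounds each \<open>dotp I g v\<close> by
    \<open>B g\<close>. The sum of exponentials has mean at most 1, which leaves
    \<open>c / l\<close>.\<close>
  define B where "B = (\<lambda>g. (c - 1 + (\<Sum>v\<in>V. e v g)) / l)"
  show thesis
  proof
    show "integrable (gauss I) B" unfolding B_def using e by auto
    show "dotp I g v \<le> B g" if v: "v \<in> V" for g v
    proof -
      have "l * dotp I g v \<le> c - 1 + e v g"
        using exp_ge_add_one_self[of "l * dotp I g v - c"] unfolding e_def by linarith
      also have "e v g \<le> (\<Sum>v\<in>V. e v g)"
        using V(1) v by (intro member_le_sum) (auto simp: e_def)
      finally show ?thesis using l by (simp add: B_def field_simps)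
    qed
    have "(\<Sum>v\<in>V. \<integral>g. e v g \<partial>gauss I) \<le> (\<Sum>v\<in>V. exp (- b\<^sup>2))"
      by (intro sum_mono e)
    also have "\<dots> \<le> exp (b\<^sup>2) * exp (- b\<^sup>2)"
      using V(3) by (simp add: mult_right_mono)
    also have "\<dots> = 1" by (simp add: mult_exp_exp)
    finally have s: "(\<Sum>v\<in>V. \<integral>g. e v g \<partial>gauss I) \<le> 1" .
    have "(\<integral>g. B g \<partial>gauss I) = (c - 1 + (\<Sum>v\<in>V. \<integral>g. e v g \<partial>gauss I)) / l"
      unfolding B_def using e by (simp add: Bochner_Integration.integral_sum prob_space)
    also have "\<dots> \<le> c / l" using s l by (intro divide_right_mono) auto
    also have "\<dots> = 17/12 * b * \<sigma>"
      using pos by (simp add: c_def l_def power2_eq_square)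
    finally show "(\<integral>g. B g \<partial>gauss I) \<le> 17/12 * b * \<sigma>" .
  qed
qed

text \<open>The arithmetic-geometric mean inequality bounds the norm by half of its square over
  \<open>a\<close> plus half of \<open>a\<close>. With \<open>a = sqrt (card I)\<close> both halves
  have equal mean.\<close>

lemma gauss_norm_majorant:
  assumes I: "finite I" "I \<noteq> {}"
  obtains B where "integrable (gauss I) B" "\<And>g. L2_set g I \<le> B g"
    "(\<integral>g. B g \<partial>gauss I) = sqrt (card I)"
proof -
  interpret prob_space "gauss I" by (rule prob_space_gauss)
  define a where "a = sqrt (card I)"
  have a: "0 < a" "a\<^sup>2 = card I" using I by (auto simp: a_def card_gt_0_iff)
  define B where "B = (\<lambda>g. ((L2_set g I)\<^sup>2 / a + a) / 2)"
  show thesis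
  proof
    show "integrable (gauss I) B" unfolding B_def by (auto simp: gauss_norm_square)
    show "L2_set g I \<le> B g" for g
    proof -
      have "0 \<le> (L2_set g I - a)\<^sup>2" by simp
      then have "2 * a * L2_set g I \<le> (L2_set g I)\<^sup>2 + a\<^sup>2"
        by (simp add: power2_diff mult_ac)
      then show ?thesis using a by (simp add: B_def field_simps power2_eq_square)
    qed
    have "(\<integral>g. B g \<partial>gauss I) = (card I / a + a) / 2"
      unfolding B_def by (simp add: gauss_norm_square prob_space)
    also have "\<dots> = sqrt (card I)"
      using a(1) unfolding a(2)[symmetric] by (simp add: power2_eq_square)
    finally show "(\<integral>g. B g \<partial>gauss I) = sqrt (card I)" .
  qed
qed

text \<open>The factor \<open>102\<close> is \<open>17/12 * 36 * 2\<close>: the links of level \<open>k\<close> have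
  length at most \<open>R / 2 ^ (k - 1)\<close>.\<close>

lemma chaining:
  assumes I: "finite I" "I \<noteq> {}" and pos: "0 < R" "0 < A"
    and S: "\<And>s. s \<in> S \<Longrightarrow> L2_set s I \<le> R"
    and fin: "\<And>k. finite (Q k)" and sub: "\<And>k. Q k \<subseteq> S"
    and cov: "\<And>k s. s \<in> S \<Longrightarrow> \<exists>q\<in>Q k. ldist I s q \<le> R / 2 ^ k"
    and card: "\<And>k. card (Q k) \<le> exp ((36 * A / (R / 2 ^ k))\<^sup>2)"
  obtains B where "integrable (gauss I) B" "\<And>g s. s \<in> S \<Longrightarrow> dotp I g s \<le> B g"
    "(\<integral>g. B g \<partial>gauss I) \<le> 102 * A * K + R / 2 ^ K * sqrt (card I)"
proof -
  \<comment> \<open>Level 0 is the origin, which lies within \<open>R\<close> of all of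
    \<open>S\<close> and contributes nothing since \<open>dotp I g\<close> vanishes there. The chain
    thus starts at no cost.\<close>
  define Q' where "Q' = (\<lambda>k. if k = 0 then {\<lambda>_. 0} else Q k)"
  have fin': "finite (Q' k)" for k using fin by (simp add: Q'_def)
  have cov': "\<exists>q\<in>Q' k. ldist I s q \<le> R / 2 ^ k" if "s \<in> S" for k s
  proof (cases "k = 0")
    case True
    then show ?thesis using S[OF that] by (simp add: Q'_def ldist_def)
  next
    case False
    then show ?thesis using cov[OF that, of k] by (simp add: Q'_def)
  qed
  have levels: "\<exists>B. integrable (gauss I) B \<and> (\<forall>g. \<forall>q\<in>Q' k. dotp I g q \<le> B g)
      \<and> (\<integral>g. B g \<partial>gauss I) \<le> 102 * A * k" for k
  proof (induction k)
    case 0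
    show ?case
      by (rule exI[of _ "\<lambda>_. 0"]) (auto simp: Q'_def dotp_def)
  next
    case (Suc k)
    then obtain B where B: "integrable (gauss I) B" "\<And>g q. q \<in> Q' k \<Longrightarrow> dotp I g q \<le> B g"
      "(\<integral>g. B g \<partial>gauss I) \<le> 102 * A * k" by blast
    \<comment> \<open>Points of the finer net lie in \<open>S\<close>, hence are covered by the
      coarser one. This gives a single link per point, so the size of the finer net bounds the
      number of links.\<close>
    have "\<forall>q\<in>Q (Suc k). \<exists>p\<in>Q' k. ldist I q p \<le> R / 2 ^ k"
      using cov' sub by blast
    then obtain p where p: "\<And>q. q \<in> Q (Suc k) \<Longrightarrow> p q \<in> Q' k"
      "\<And>q. q \<in> Q (Suc k) \<Longrightarrow> ldist I q (p q) \<le> R / 2 ^ k" by metis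
    let ?V = "(\<lambda>q i. q i - p q i) ` Q (Suc k)"
    let ?b = "36 * A / (R / 2 ^ Suc k)"
    have "real (card ?V) \<le> card (Q (Suc k))" using fin by (simp add: card_image_le)
    also have "\<dots> \<le> exp (?b\<^sup>2)" by (rule card)
    finally have cV: "card ?V \<le> exp (?b\<^sup>2)" .
    obtain B' where B': "integrable (gauss I) B'" "\<And>g v. v \<in> ?V \<Longrightarrow> dotp I g v \<le> B' g"
      "(\<integral>g. B' g \<partial>gauss I) \<le> 17/12 * ?b * (R / 2 ^ k)"
    proof (rule gauss_finite_majorant[OF I(1) _ _ cV, of "R / 2 ^ k"])
      show "finite ?V" using fin by simp
      show "L2_set v I \<le> R / 2 ^ k" if "v \<in> ?V" for v
        using that p(2) unfolding ldist_def by blast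
      show "0 < R / 2 ^ k" "0 < ?b" using pos by simp_all
    qed (rule that)
    have "17/12 * ?b * (R / 2 ^ k) = 102 * A" using pos by simp
    then have B'_le: "(\<integral>g. B' g \<partial>gauss I) \<le> 102 * A" using B'(3) by simp
    have "dotp I g q \<le> B' g + B g" if q: "q \<in> Q (Suc k)" for g q
    proof -
      have "dotp I g (\<lambda>i. q i - p q i) \<le> B' g" using q by (intro B'(2) imageI)
      then show ?thesis using B(2)[OF p(1)[OF q], of g] by (simp add: dotp_diff_right)
    qed
    moreover have "(\<integral>g. B' g + B g \<partial>gauss I) \<le> 102 * A * Suc k"
      using B(1,3) B'(1) B'_le by (simp add: distrib_left)
    ultimately show ?case
      using B(1) B'(1) by (intro exI[of _ "\<lambda>g. B' g + B g"]) (auto simp: Q'_def)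
  qed
  from levels[of K] obtain B where B: "integrable (gauss I) B" "\<And>g q. q \<in> Q' K \<Longrightarrow> dotp I g q \<le> B g"
    "(\<integral>g. B g \<partial>gauss I) \<le> 102 * A * K" by blast
  obtain N where N: "integrable (gauss I) N" "\<And>g. L2_set g I \<le> N g"
    "(\<integral>g. N g \<partial>gauss I) = sqrt (card I)"
    using gauss_norm_majorant[OF I] by blast
  show thesis
  proof
    show "integrable (gauss I) (\<lambda>g. B g + R / 2 ^ K * N g)"
      using B(1) N(1) by simp
    show "dotp I g s \<le> B g + R / 2 ^ K * N g" if s: "s \<in> S" for g s
    proof -
      obtain q where q: "q \<in> Q' K" "ldist I s q \<le> R / 2 ^ K" using cov'[OF s] by blast
      have "dotp I g s = dotp I g q + dotp I g (\<lambda>i. s i - q i)" by (simp add: dotp_diff_right)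
      \<comment> \<open>The chain stops at level \<open>K\<close>; the remainder is handled by
        Cauchy-Schwarz and the majorant of the norm of \<open>g\<close>.\<close>
      also have "dotp I g (\<lambda>i. s i - q i) \<le> L2_set g I * ldist I s q"
        unfolding ldist_def by (rule dotp_le)
      also have "\<dots> \<le> N g * (R / 2 ^ K)"
        using N(2)[of g] q(2) order_trans[OF L2_set_nonneg N(2)[of g]] by (intro mult_mono) (auto simp: ldist_nonneg)
      finally show ?thesis using B(2)[OF q(1), of g] by (simp add: mult.commute)
    qed
    show "(\<integral>g. B g + R / 2 ^ K * N g \<partial>gauss I) \<le> 102 * A * K + R / 2 ^ K * sqrt (card I)"
      using B(1,3) N(1,3) by simp
  qed
qed

text \<open>The comparison in terms of vectors and uniformly Lipschitz maps. The strict inequality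
  for \<open>A\<close> makes it positive even when both widths vanish, as chaining requires.\<close>

lemma gauss_chain_rule:
  fixes T :: "('i \<Rightarrow> real) set" and \<Phi> :: "(('i \<Rightarrow> real) \<Rightarrow> ('j \<Rightarrow> real)) set"
  assumes I: "finite I" and J: "finite J" "J \<noteq> {}" and pos: "0 < R" "0 < L"
    and ne: "T \<noteq> {}" "\<Phi> \<noteq> {}"
    and lip: "\<And>\<phi> u v. \<phi> \<in> \<Phi> \<Longrightarrow> ldist J (\<phi> u) (\<phi> v) \<le> L * ldist I u v"
    and bd: "\<And>\<phi> t. \<phi> \<in> \<Phi> \<Longrightarrow> t \<in> T \<Longrightarrow> L2_set (\<phi> t) J \<le> R"
    and w: "\<And>P. finite P \<Longrightarrow> P \<noteq> {} \<Longrightarrow> P \<subseteq> T \<Longrightarrow> gauss_width I P \<le> w"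
    and W: "\<And>P t. t \<in> T \<Longrightarrow> finite P \<Longrightarrow> P \<noteq> {} \<Longrightarrow> P \<subseteq> (\<lambda>\<phi>. \<phi> t) ` \<Phi> \<Longrightarrow> gauss_width J P \<le> W"
    and A: "L * w + W < A"
  obtains B where "integrable (gauss J) B"
    "\<And>g \<phi> t. \<phi> \<in> \<Phi> \<Longrightarrow> t \<in> T \<Longrightarrow> dotp J g (\<phi> t) \<le> B g"
    "(\<integral>g. B g \<partial>gauss J) \<le> 102 * A * K + R / 2 ^ K * sqrt (card J)"
proof -
  obtain t0 \<phi>0 where t0: "t0 \<in> T" "\<phi>0 \<in> \<Phi>" using ne by auto
  have "0 \<le> gauss_width I {t0}" "0 \<le> gauss_width J {\<phi>0 t0}"
    by (auto intro: gauss_width_nonneg)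
  then have nn: "0 \<le> w" "0 \<le> W"
    using w[of "{t0}"] W[of t0 "{\<phi>0 t0}"] t0 by auto
  then have A0: "0 < A"
    using A pos(2) mult_nonneg_nonneg[of L w] by linarith
  define S where "S = {\<phi> t | \<phi> t. \<phi> \<in> \<Phi> \<and> t \<in> T}"
  have net: "\<exists>Q. finite Q \<and> Q \<subseteq> S \<and> (\<forall>s\<in>S. \<exists>q\<in>Q. ldist J s q \<le> \<eta>) \<and> card Q \<le> exp ((36 * A / \<eta>)\<^sup>2)"
    if \<eta>: "0 < \<eta>" for \<eta>
  proof -
    obtain U where U: "finite U" "U \<noteq> {}" "U \<subseteq> T"
      "\<And>t. t \<in> T \<Longrightarrow> \<exists>u\<in>U. ldist I t u \<le> \<eta> / (2 * L)" "card U \<le> exp ((18 * w / (\<eta> / (2 * L)))\<^sup>2)"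
      by (rule sudakov_net[OF I _ ne(1) w, of "\<eta> / (2 * L)"]) (use \<eta> pos in auto)
    have "\<forall>u\<in>U. \<exists>Z. finite Z \<and> Z \<subseteq> (\<lambda>\<phi>. \<phi> u) ` \<Phi>
        \<and> (\<forall>s\<in>(\<lambda>\<phi>. \<phi> u) ` \<Phi>. \<exists>z\<in>Z. ldist J s z \<le> \<eta> / 2) \<and> card Z \<le> exp ((18 * W / (\<eta> / 2))\<^sup>2)"
    proof
      fix u assume "u \<in> U"
      then have u: "u \<in> T" using U by auto
      show "\<exists>Z. finite Z \<and> Z \<subseteq> (\<lambda>\<phi>. \<phi> u) ` \<Phi>
        \<and> (\<forall>s\<in>(\<lambda>\<phi>. \<phi> u) ` \<Phi>. \<exists>z\<in>Z. ldist J s z \<le> \<eta> / 2) \<and> card Z \<le> exp ((18 * W / (\<eta> / 2))\<^sup>2)"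
        by (rule sudakov_net[OF J(1) _ _ W[OF u], of "\<eta> / 2" "(\<lambda>\<phi>. \<phi> u) ` \<Phi>"])
          (use \<eta> ne in auto)
    qed
    from bchoice[OF this] obtain Z where Z': "\<forall>u\<in>U. finite (Z u) \<and> Z u \<subseteq> (\<lambda>\<phi>. \<phi> u) ` \<Phi>
        \<and> (\<forall>s\<in>(\<lambda>\<phi>. \<phi> u) ` \<Phi>. \<exists>z\<in>Z u. ldist J s z \<le> \<eta> / 2)
        \<and> card (Z u) \<le> exp ((18 * W / (\<eta> / 2))\<^sup>2)" ..
    have Z: "finite (Z u)" "Z u \<subseteq> (\<lambda>\<phi>. \<phi> u) ` \<Phi>"
      "card (Z u) \<le> exp ((18 * W / (\<eta> / 2))\<^sup>2)" if "u \<in> U" for u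
      using bspec[OF Z' that] by simp_all
    have Z_cov: "\<exists>z\<in>Z u. ldist J (\<phi> u) z \<le> \<eta> / 2" if "u \<in> U" "\<phi> \<in> \<Phi>" for u \<phi>
      using bspec[OF Z' that(1)] that(2) by simp
    let ?Q = "\<Union>u\<in>U. Z u"
    have "real (card ?Q) \<le> real (\<Sum>u\<in>U. card (Z u))"
      using card_UN_le[OF U(1), of Z] by (metis of_nat_le_iff)
    also have "\<dots> \<le> (\<Sum>u\<in>U. exp ((18 * W / (\<eta> / 2))\<^sup>2))"
      unfolding of_nat_sum by (intro sum_mono Z)
    also have "\<dots> = card U * exp ((18 * W / (\<eta> / 2))\<^sup>2)" by simp
    also have "\<dots> \<le> exp ((18 * w / (\<eta> / (2 * L)))\<^sup>2) * exp ((18 * W / (\<eta> / 2))\<^sup>2)"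
      by (intro mult_right_mono U) auto
    also have "\<dots> = exp ((36 * (L * w) / \<eta>)\<^sup>2 + (36 * W / \<eta>)\<^sup>2)"
      by (simp add: mult_exp_exp mult_ac)
    \<comment> \<open>Exponents of the two nets add as squares; both widths being nonnegative, the
      square of the sum dominates.\<close>
    also have "\<dots> \<le> exp ((36 * A / \<eta>)\<^sup>2)"
    proof -
      have "(L * w)\<^sup>2 + W\<^sup>2 \<le> (L * w + W)\<^sup>2"
        using nn pos by (simp add: power2_sum)
      also have "\<dots> \<le> A\<^sup>2" using A nn pos by (intro power_mono) auto
      finally have "(36 / \<eta>)\<^sup>2 * ((L * w)\<^sup>2 + W\<^sup>2) \<le> (36 / \<eta>)\<^sup>2 * A\<^sup>2"
        by (intro mult_left_mono) auto
      then show ?thesis by (simp add: power_mult_distrib power_divide distrib_left)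
    qed
    finally have cQ: "card ?Q \<le> exp ((36 * A / \<eta>)\<^sup>2)" .
    have cov: "\<exists>q\<in>?Q. ldist J s q \<le> \<eta>" if s_in: "s \<in> S" for s
    proof -
      obtain \<phi> t where s: "s = \<phi> t" "\<phi> \<in> \<Phi>" "t \<in> T" using s_in by (auto simp: S_def)
      obtain u where u: "u \<in> U" "ldist I t u \<le> \<eta> / (2 * L)" using U(4)[OF s(3)] by blast
      obtain z where z: "z \<in> Z u" "ldist J (\<phi> u) z \<le> \<eta> / 2" using Z_cov[OF u(1) s(2)] by blast
      have "L * ldist I t u \<le> L * (\<eta> / (2 * L))" using u pos by (intro mult_left_mono) auto
      then have "L * ldist I t u \<le> \<eta> / 2" using pos by simp
      then have "ldist J s z \<le> \<eta>"
        using ldist_triangle[of J s z "\<phi> u"] z(2) lip[OF s(2), of t u] s(1) by simp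
      then show ?thesis using u z by blast
    qed
    have "?Q \<subseteq> S" using Z(2) U(3) unfolding S_def by blast
    then show ?thesis using U(1) Z(1) cov cQ by (intro exI[of _ ?Q]) auto
  qed
  have "\<exists>Q. finite Q \<and> Q \<subseteq> S \<and> (\<forall>s\<in>S. \<exists>q\<in>Q. ldist J s q \<le> R / 2 ^ k)
      \<and> card Q \<le> exp ((36 * A / (R / 2 ^ k))\<^sup>2)" for k :: nat
    by (rule net) (use pos in simp)
  then have "\<forall>k. \<exists>Q. finite Q \<and> Q \<subseteq> S \<and> (\<forall>s\<in>S. \<exists>q\<in>Q. ldist J s q \<le> R / 2 ^ k)
      \<and> card Q \<le> exp ((36 * A / (R / 2 ^ k))\<^sup>2)" by blast
  from choice[OF this] obtain Q where Q': "\<forall>k. finite (Q k) \<and> Q k \<subseteq> S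
      \<and> (\<forall>s\<in>S. \<exists>q\<in>Q k. ldist J s q \<le> R / 2 ^ k) \<and> card (Q k) \<le> exp ((36 * A / (R / 2 ^ k))\<^sup>2)" ..
  have Q: "finite (Q k)" "Q k \<subseteq> S" "s \<in> S \<Longrightarrow> \<exists>q\<in>Q k. ldist J s q \<le> R / 2 ^ k"
      "card (Q k) \<le> exp ((36 * A / (R / 2 ^ k))\<^sup>2)" for k s
    using spec[OF Q', of k] by simp_all
  have S_bd: "L2_set s J \<le> R" if "s \<in> S" for s
    using that bd by (auto simp: S_def)
  obtain B where B: "integrable (gauss J) B" "\<And>g s. s \<in> S \<Longrightarrow> dotp J g s \<le> B g"
    "(\<integral>g. B g \<partial>gauss J) \<le> 102 * A * K + R / 2 ^ K * sqrt (card J)"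
    by (rule chaining[where K=K, OF J pos(1) A0 S_bd Q]) (assumption, assumption, rule that)
  show thesis
  proof (rule that[OF B(1) _ B(3)])
    show "dotp J g (\<phi> t) \<le> B g" if "\<phi> \<in> \<Phi>" "t \<in> T" for g \<phi> t
      using that by (intro B(2)) (auto simp: S_def)
  qed
qed

section \<open>Empirical Gaussian complexities\<close>

text \<open>The nonnegative integral is monotone on arbitrary functions, so suprema over infinite
  classes can be compared directly.\<close>

lemma ereal_expectation_mono:
  assumes "\<And>w. w \<in> space M \<Longrightarrow> Z w \<le> Z' w"
  shows "ereal_expectation M Z \<le> ereal_expectation M Z'"
  unfolding ereal_expectation_def using assms
  by (intro ereal_minus_mono) (auto intro!: nn_integral_mono e2ennreal_mono simp flip: less_eq_ennreal.rep_eq)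

lemma ereal_expectation_ereal:
  assumes "integrable M B"
  shows "ereal_expectation M (\<lambda>w. ereal (B w)) = ereal (\<integral>w. B w \<partial>M)"
proof -
  have fin: "(\<integral>\<^sup>+w. ennreal (B w) \<partial>M) < \<top>" "(\<integral>\<^sup>+w. ennreal (- B w) \<partial>M) < \<top>"
    using assms by (auto simp: real_integrable_def less_top)
  then have e: "enn2ereal (\<integral>\<^sup>+w. ennreal (B w) \<partial>M) = ereal (enn2real (\<integral>\<^sup>+w. ennreal (B w) \<partial>M))"
    "enn2ereal (\<integral>\<^sup>+w. ennreal (- B w) \<partial>M) = ereal (enn2real (\<integral>\<^sup>+w. ennreal (- B w) \<partial>M))"
    by (metis enn2ereal_ennreal enn2real_nonneg ennreal_enn2real)+
  show ?thesis
    by (simp add: ereal_expectation_def real_lebesgue_integral_def[OF assms] e)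
qed

definition coord :: "(nat \<Rightarrow> 'a) \<Rightarrow> ('a \<Rightarrow> real ^ 'q) \<Rightarrow> 'q \<times> nat \<Rightarrow> real" where
  "coord x Q = (\<lambda>(j, i). Q (x i) $ j)"

lemma emp_gaussian_complexity_dotp:
  fixes \<Q> :: "('a \<Rightarrow> real ^ 'q) set"
  shows "emp_gaussian_complexity n x \<Q> = ereal_expectation (gauss (UNIV \<times> {1..n}))
    (\<lambda>g. SUP Q\<in>\<Q>. ereal (dotp (UNIV \<times> {1..n}) g (coord x Q) / n))"
  by (simp add: emp_gaussian_complexity_def iid_std_normal_def gauss_def dotp_def coord_def
      sum.cartesian_product split_beta)

lemma emp_gaussian_complexity_le:
  fixes \<Q> :: "('a \<Rightarrow> real ^ 'q) set"
  assumes B: "integrable (gauss (UNIV \<times> {1..n})) B"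
    "\<And>g Q. Q \<in> \<Q> \<Longrightarrow> dotp (UNIV \<times> {1..n}) g (coord x Q) \<le> B g"
  shows "emp_gaussian_complexity n x \<Q> \<le> ereal ((\<integral>g. B g \<partial>gauss (UNIV \<times> {1..n})) / n)"
proof -
  have "emp_gaussian_complexity n x \<Q> \<le> ereal_expectation (gauss (UNIV \<times> {1..n})) (\<lambda>g. ereal (B g / n))"
    unfolding emp_gaussian_complexity_dotp using B(2)
    by (intro ereal_expectation_mono SUP_least) (simp add: divide_right_mono)
  also have "\<dots> = ereal ((\<integral>g. B g \<partial>gauss (UNIV \<times> {1..n})) / n)"
    using B(1) by (subst ereal_expectation_ereal) auto
  finally show ?thesis .
qed

text \<open>Supplies the width bounds on finite subsets that \<open>gauss_chain_rule\<close> takes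
  as hypotheses.\<close>

lemma gauss_width_le_emp:
  fixes \<Q> :: "('a \<Rightarrow> real ^ 'q) set"
  assumes P: "finite P" "P \<noteq> {}" "P \<subseteq> coord x ` \<Q>"
  shows "ereal (gauss_width (UNIV \<times> {1..n}) P / n) \<le> emp_gaussian_complexity n x \<Q>"
proof -
  let ?J = "UNIV \<times> {1..n} :: ('q \<times> nat) set"
  have "ereal (gauss_width ?J P / n) = ereal_expectation (gauss ?J) (\<lambda>g. ereal ((MAX v\<in>P. dotp ?J g v) / n))"
    using integrable_Max_dotp[OF P(1,2)] by (subst ereal_expectation_ereal) (auto simp: gauss_width_def)
  also have "\<dots> \<le> emp_gaussian_complexity n x \<Q>"
    unfolding emp_gaussian_complexity_dotp
  proof (rule ereal_expectation_mono)
    fix g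
    have "(MAX v\<in>P. dotp ?J g v) \<in> dotp ?J g ` P" using P by (intro Max_in) auto
    then obtain Q where Q: "Q \<in> \<Q>" "(MAX v\<in>P. dotp ?J g v) = dotp ?J g (coord x Q)"
      using P(3) by auto
    show "ereal ((MAX v\<in>P. dotp ?J g v) / n) \<le> (SUP Q\<in>\<Q>. ereal (dotp ?J g (coord x Q) / n))"
      unfolding Q(2) using Q(1) by (rule SUP_upper)
  qed
  finally show ?thesis .
qed

lemma emp_gaussian_complexity_nonneg:
  assumes "\<Q> \<noteq> {}"
  shows "0 \<le> emp_gaussian_complexity n x \<Q>"
proof -
  obtain Q where Q: "Q \<in> \<Q>" using assms by auto
  have "0 \<le> ereal (gauss_width (UNIV \<times> {1..n}) {coord x Q} / n)"
    by (simp add: gauss_width_nonneg)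
  also have "\<dots> \<le> emp_gaussian_complexity n x \<Q>"
    using Q by (intro gauss_width_le_emp) auto
  finally show ?thesis .
qed

lemma emp_gaussian_complexity_empty: "emp_gaussian_complexity n x ({} :: ('a \<Rightarrow> real ^ 'q) set) = - \<infinity>"
proof -
  have "e2ennreal \<infinity> = \<top>" by (metis e2ennreal_enn2ereal enn2ereal_top)
  then show ?thesis
    by (simp add: emp_gaussian_complexity_dotp ereal_expectation_def e2ennreal_neg bot_ereal_def
        prob_space.emeasure_space_1[OF prob_space_gauss] zero_ennreal.rep_eq)
qed

section \<open>Block structure of the sample vectors\<close>

lemma L2_set_blocks:
  "(L2_set (\<lambda>(j, i). y i $ j) (UNIV \<times> {1..n}))\<^sup>2 = (\<Sum>i=1..n. (norm (y i :: real ^ 'q))\<^sup>2)"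
proof -
  have "(L2_set (\<lambda>(j, i). y i $ j) (UNIV \<times> {1..n}))\<^sup>2 = (\<Sum>p\<in>UNIV \<times> {1..n}. (y (snd p) $ fst p)\<^sup>2)"
    by (simp add: L2_set_def sum_nonneg split_beta)
  also have "\<dots> = (\<Sum>j\<in>UNIV. \<Sum>i=1..n. (y i $ j)\<^sup>2)"
    by (simp add: sum.cartesian_product split_beta)
  also have "\<dots> = (\<Sum>i=1..n. \<Sum>j\<in>UNIV. (y i $ j)\<^sup>2)"
    by (rule sum.swap)
  also have "\<dots> = (\<Sum>i=1..n. (norm (y i))\<^sup>2)"
    by (simp add: norm_vec_def L2_set_def sum_nonneg)
  finally show ?thesis .
qed

definition lift :: "(real ^ 'r \<Rightarrow> real ^ 'q) \<Rightarrow> ('r \<times> nat \<Rightarrow> real) \<Rightarrow> 'q \<times> nat \<Rightarrow> real" where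
  "lift f v = (\<lambda>(j, i). f (\<chi> r. v (r, i)) $ j)"

text \<open>The same vector has two readings. The first places it in the composed class at the
  inputs; the second places it in the outer class at the points \<open>h (x i)\<close>, where the
  worst-case complexity applies.\<close>

lemma lift_coord: "lift f (coord x h) = coord x (f \<circ> h)" "lift f (coord x h) = coord (\<lambda>i. h (x i)) f"
  by (auto simp: lift_def coord_def)

text \<open>The squared distance is a sum over the \<open>n\<close> sample blocks, and
  \<open>f\<close> contracts or expands each block by at most \<open>L\<close>.\<close>

lemma ldist_lift:
  assumes f: "L-lipschitz_on UNIV f"
  shows "ldist (UNIV \<times> {1..n}) (lift f u) (lift f v) \<le> L * ldist (UNIV \<times> {1..n}) u v"
proof (rule power2_le_imp_le)
  have L: "0 \<le> L" using f by (rule lipschitz_on_nonneg)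
  let ?u = "\<lambda>i. \<chi> r. u (r, i)" and ?v = "\<lambda>i. \<chi> r. v (r, i)"
  have "(ldist (UNIV \<times> {1..n}) (lift f u) (lift f v))\<^sup>2 = (\<Sum>i=1..n. (norm (f (?u i) - f (?v i)))\<^sup>2)"
    unfolding L2_set_blocks[symmetric] ldist_def lift_def by (simp add: case_prod_unfold)
  also have "\<dots> \<le> (\<Sum>i=1..n. L\<^sup>2 * (norm (?u i - ?v i))\<^sup>2)"
    unfolding power_mult_distrib[symmetric]
    using lipschitz_on_normD[OF f] by (intro sum_mono power_mono) auto
  also have "\<dots> = (L * ldist (UNIV \<times> {1..n}) u v)\<^sup>2"
    unfolding power_mult_distrib sum_distrib_left[symmetric] L2_set_blocks[symmetric] ldist_def
    by (simp add: case_prod_unfold)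
  finally show "(ldist (UNIV \<times> {1..n}) (lift f u) (lift f v))\<^sup>2 \<le> (L * ldist (UNIV \<times> {1..n}) u v)\<^sup>2" .
  show "0 \<le> L * ldist (UNIV \<times> {1..n}) u v" using L by simp
qed

lemma L2_set_coord_le:
  fixes Q :: "'a \<Rightarrow> real ^ 'q"
  assumes "\<And>i. i \<in> {1..n} \<Longrightarrow> norm (Q (x i)) \<le> D" "0 \<le> D"
  shows "L2_set (coord x Q) (UNIV \<times> {1..n}) \<le> sqrt n * D"
proof (rule power2_le_imp_le)
  have "(L2_set (coord x Q) (UNIV \<times> {1..n}))\<^sup>2 = (\<Sum>i=1..n. (norm (Q (x i)))\<^sup>2)"
    unfolding coord_def by (rule L2_set_blocks)
  also have "\<dots> \<le> (\<Sum>i=1..n. D\<^sup>2)"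
    using assms by (intro sum_mono power_mono) auto
  also have "\<dots> = (sqrt n * D)\<^sup>2" by (simp add: power_mult_distrib)
  finally show "(L2_set (coord x Q) (UNIV \<times> {1..n}))\<^sup>2 \<le> (sqrt n * D)\<^sup>2" .
qed (use assms in simp)

text \<open>Cauchy-Schwarz against the norm of the Gaussian vector. This crude bound settles the
  cases \<open>n = 1\<close> and \<open>D = 0\<close>, which chaining leaves out.\<close>

lemma emp_gaussian_complexity_bounded:
  fixes \<Q> :: "('a \<Rightarrow> real ^ 'q) set"
  assumes n: "n \<ge> 1" and bd: "\<And>Q i. Q \<in> \<Q> \<Longrightarrow> i \<in> {1..n} \<Longrightarrow> norm (Q (x i)) \<le> D" and D: "0 \<le> D"
  shows "emp_gaussian_complexity n x \<Q> \<le> ereal (sqrt CARD('q) * D)"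
proof -
  let ?J = "UNIV \<times> {1..n} :: ('q \<times> nat) set"
  obtain N where N: "integrable (gauss ?J) N" "\<And>g. L2_set g ?J \<le> N g"
    "(\<integral>g. N g \<partial>gauss ?J) = sqrt (card ?J)"
    using gauss_norm_majorant[of ?J] n by auto
  have "dotp ?J g (coord x Q) \<le> N g * (sqrt n * D)" if Q: "Q \<in> \<Q>" for g Q
  proof -
    have "dotp ?J g (coord x Q) \<le> L2_set g ?J * L2_set (coord x Q) ?J" by (rule dotp_le)
    also have "\<dots> \<le> N g * (sqrt n * D)"
      using N(2)[of g] order_trans[OF L2_set_nonneg N(2)[of g]] D bd[OF Q]
      by (intro mult_mono L2_set_coord_le) auto
    finally show ?thesis .
  qed
  then have "emp_gaussian_complexity n x \<Q> \<le> ereal ((\<integral>g. N g * (sqrt n * D) \<partial>gauss ?J) / n)"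
    using N(1) by (intro emp_gaussian_complexity_le) auto
  also have "(\<integral>g. N g * (sqrt n * D) \<partial>gauss ?J) / n = sqrt CARD('q) * D"
  proof -
    have "(\<integral>g. N g * (sqrt n * D) \<partial>gauss ?J) = sqrt CARD('q) * sqrt n * (sqrt n * D)"
      using N(1,3) by (simp add: card_cartesian_product real_sqrt_mult)
    also have "\<dots> / n = sqrt CARD('q) * D * (sqrt n * sqrt n) / n"
      by (simp only: mult_ac)
    also have "\<dots> = sqrt CARD('q) * D"
      using n by (simp only: real_sqrt_mult_self) simp
    finally show ?thesis .
  qed
  finally show ?thesis .
qed

section \<open>The logarithmic bound and its degenerate cases\<close>

text \<open>For \<open>n \<ge> 2\<close> the binary logarithm is at least 1 and absorbs the
  rounding; \<open>ln 2 \<ge> 2/3\<close> then turns 3 binary logarithms into at most 5 natural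
  ones.\<close>

lemma dyadic_levels:
  assumes "n \<ge> 2"
  obtains K :: nat where "(real n)\<^sup>2 \<le> 2 ^ K" "real K \<le> 5 * ln n"
proof
  let ?l = "log 2 (real n)"
  define K where "K = nat \<lceil>2 * ?l\<rceil>"
  have l: "1 \<le> ?l" using assms by simp
  have n: "real n = 2 powr ?l" using assms by simp
  have "(real n)\<^sup>2 = 2 powr (2 * ?l)"
    by (subst n) (simp add: powr_powr[symmetric] powr_add[symmetric] power2_eq_square del: powr_log_cancel)
  also have "\<dots> \<le> 2 powr real K"
    using l by (intro powr_mono) (auto simp: K_def)
  finally show "(real n)\<^sup>2 \<le> 2 ^ K" by (simp add: powr_realpow)
  have "real K \<le> 2 * ?l + 1" using l by (auto simp: K_def) 
  also have "\<dots> \<le> 3 * ?l" using l by simp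
  also have "\<dots> \<le> 5 * ln n"
  proof -
    have "?l * (2/3) \<le> ?l * ln 2"
      using l ln2_ge_two_thirds by (intro mult_left_mono) auto
    also have "?l * ln 2 = ln n" by (simp add: log_def)
    finally show ?thesis using l by simp
  qed
  finally show "real K \<le> 5 * ln n" .
qed

lemma emp_gaussian_complexity_comp_le:
  fixes \<H> :: "('a \<Rightarrow> real ^ 'r) set" and \<F> :: "(real ^ 'r \<Rightarrow> real ^ 'q) set"
  assumes n: "n \<ge> 2" and pos: "0 < L" "0 < D" and ne: "\<H> \<noteq> {}" "\<F> \<noteq> {}"
    and lip: "\<And>f. f \<in> \<F> \<Longrightarrow> L-lipschitz_on UNIV f"
    and bd: "\<And>f h i. f \<in> \<F> \<Longrightarrow> h \<in> \<H> \<Longrightarrow> i \<in> {1..n} \<Longrightarrow> norm (f (h (x i))) \<le> D"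
    and a: "emp_gaussian_complexity n x \<H> \<le> ereal a"
    and b: "\<And>h. h \<in> \<H> \<Longrightarrow> emp_gaussian_complexity n (\<lambda>i. h (x i)) \<F> \<le> ereal b"
    and A: "L * a + b < A"
  shows "emp_gaussian_complexity n x (class_comp \<F> \<H>)
    \<le> ereal (sqrt CARD('q) * D / (real n)\<^sup>2 + 510 * A * ln n)"
proof -
  let ?I = "UNIV \<times> {1..n} :: ('r \<times> nat) set" and ?J = "UNIV \<times> {1..n} :: ('q \<times> nat) set"
  obtain K :: nat where K: "(real n)\<^sup>2 \<le> 2 ^ K" "real K \<le> 5 * ln n"
    using dyadic_levels[OF n] by blast
  have n0: "0 < real n" using n by simp
  define R where "R = sqrt n * D"
  have R: "0 < R" using n0 pos by (simp add: R_def)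
  have A0: "0 < A"
  proof -
    obtain h where h: "h \<in> \<H>" using ne by auto
    have "0 \<le> ereal a" using emp_gaussian_complexity_nonneg[OF ne(1)] a by (rule order_trans)
    moreover have "0 \<le> ereal b" using emp_gaussian_complexity_nonneg[OF ne(2)] b[OF h] by (rule order_trans)
    ultimately have "0 \<le> L * a + b" using pos by simp
    then show ?thesis using A by linarith
  qed
  obtain B where B: "integrable (gauss ?J) B"
    "\<And>g \<phi> t. \<phi> \<in> lift ` \<F> \<Longrightarrow> t \<in> coord x ` \<H> \<Longrightarrow> dotp ?J g (\<phi> t) \<le> B g"
    "(\<integral>g. B g \<partial>gauss ?J) \<le> 102 * (n * A) * K + R / 2 ^ K * sqrt (card ?J)"
  \<comment> \<open>Widths are \<open>n\<close> times complexities, hence the factors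
    \<open>n\<close>. With at most \<open>5 * ln n\<close> levels the constant becomes
    \<open>102 * 5 = 510\<close>.\<close>
  proof (rule gauss_chain_rule[of ?I ?J R L "coord x ` \<H>" "lift ` \<F>" "n * a" "n * b" "n * A" K])
    show "ldist ?J (\<phi> u) (\<phi> v) \<le> L * ldist ?I u v" if "\<phi> \<in> lift ` \<F>" for \<phi> u v
      using that ldist_lift[OF lip, of _ n u v] by blast
    show "L2_set (\<phi> t) ?J \<le> R" if \<phi>t: "\<phi> \<in> lift ` \<F>" "t \<in> coord x ` \<H>" for \<phi> t
    proof -
      obtain f h where fh: "f \<in> \<F>" "h \<in> \<H>" "\<phi> = lift f" "t = coord x h"
        using \<phi>t by blast
      have "L2_set (coord x (f \<circ> h)) ?J \<le> R"
        unfolding R_def using bd[OF fh(1,2)] pos by (intro L2_set_coord_le) auto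
      then show ?thesis by (simp add: fh lift_coord(1))
    qed
    show "gauss_width ?I P \<le> n * a" if P: "finite P" "P \<noteq> {}" "P \<subseteq> coord x ` \<H>" for P
    proof -
      have "ereal (gauss_width ?I P / n) \<le> ereal a"
        using gauss_width_le_emp[OF P] a by (rule order_trans)
      then show ?thesis using n0 by (simp add: field_simps)
    qed
    show "gauss_width ?J P \<le> n * b"
      if t: "t \<in> coord x ` \<H>" and P: "finite P" "P \<noteq> {}" "P \<subseteq> (\<lambda>\<phi>. \<phi> t) ` lift ` \<F>" for P t
    proof -
      obtain h where h: "h \<in> \<H>" "t = coord x h" using t by auto
      have "P \<subseteq> coord (\<lambda>i. h (x i)) ` \<F>"
        using P(3) unfolding h(2) image_image lift_coord(2) .
      then have "ereal (gauss_width ?J P / n) \<le> emp_gaussian_complexity n (\<lambda>i. h (x i)) \<F>"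
        by (intro gauss_width_le_emp P)
      then have "ereal (gauss_width ?J P / n) \<le> ereal b"
        using b[OF h(1)] by (rule order_trans)
      then show ?thesis using n0 by (simp add: field_simps)
    qed
    have "n * (L * a + b) < n * A" using A n0 by (rule mult_strict_left_mono)
    then show "L * (n * a) + n * b < n * A" by (simp add: algebra_simps)
  qed (use n R pos ne in auto)
  have "emp_gaussian_complexity n x (class_comp \<F> \<H>) \<le> ereal ((\<integral>g. B g \<partial>gauss ?J) / n)"
  proof (rule emp_gaussian_complexity_le[OF B(1)])
    fix g Q assume "Q \<in> class_comp \<F> \<H>"
    then obtain f h where fh: "Q = f \<circ> h" "f \<in> \<F>" "h \<in> \<H>" by (auto simp: class_comp_def)
    then show "dotp ?J g (coord x Q) \<le> B g"
      using B(2)[of "lift f" "coord x h" g] by (simp add: lift_coord(1))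
  qed
  also have "(\<integral>g. B g \<partial>gauss ?J) / n \<le> (102 * (n * A) * K + R / 2 ^ K * sqrt (card ?J)) / n"
    using B(3) n0 by (intro divide_right_mono) auto
  also have "\<dots> = R * sqrt (card ?J) / n / 2 ^ K + 102 * A * K"
    using n0 by (simp add: field_simps)
  also have "R * sqrt (card ?J) = sqrt n * D * (sqrt CARD('q) * sqrt n)"
    by (simp add: R_def card_cartesian_product real_sqrt_mult)
  also have "\<dots> / n = sqrt CARD('q) * D * (sqrt n * sqrt n) / n"
    by (simp only: mult_ac)
  also have "\<dots> = sqrt CARD('q) * D"
    using n0 by (simp only: real_sqrt_mult_self) simp
  also have "sqrt CARD('q) * D / 2 ^ K + 102 * A * K \<le> sqrt CARD('q) * D / (real n)\<^sup>2 + 510 * A * ln n"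
  proof (rule add_mono)
    show "sqrt CARD('q) * D / 2 ^ K \<le> sqrt CARD('q) * D / (real n)\<^sup>2"
      using K(1) n0 pos by (intro divide_left_mono) auto
    have "102 * A * K \<le> 102 * A * (5 * ln n)"
      using A0 K(2) by (intro mult_left_mono) auto
    then show "102 * A * K \<le> 510 * A * ln n" by simp
  qed
  finally show ?thesis by simp
qed

theorem lemmaA2:
  fixes \<H> :: "(real ^ 'd \<Rightarrow> real ^ 'r) set"
    and \<F> :: "(real ^ 'r \<Rightarrow> real ^ 'q) set"
    and X :: "(real ^ 'd) set"
    and x :: "nat \<Rightarrow> real ^ 'd"
    and n k :: nat
    and L D :: real
    and C :: ereal
  assumes k: "CARD('q) = k - 1"
    and n: "n \<ge> 1"
    and lipschitz: "\<And>f. f \<in> \<F> \<Longrightarrow> L-lipschitz_on UNIV f"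
    and bounded: "\<And>f h z. f \<in> \<F> \<Longrightarrow> h \<in> \<H> \<Longrightarrow> z \<in> X \<Longrightarrow> norm ((f \<circ> h) z) \<le> D"
    and inputs: "\<And>i. i \<in> {1..n} \<Longrightarrow> x i \<in> X"
    and C: "C = ereal L * emp_gaussian_complexity n x \<H> + worst_gaussian_complexity n X \<H> \<F>"
  shows "emp_gaussian_complexity n x (class_comp \<F> \<H>)
      \<le> ereal (8 * sqrt (real (k - 1)) * D / (real n)\<^sup>2) + 512 * C * ereal (ln (real n))"
proof (cases "\<F> = {} \<or> \<H> = {}")
  case True
  then have "class_comp \<F> \<H> = {}" by (auto simp: class_comp_def)
  then show ?thesis by (simp add: emp_gaussian_complexity_empty)
next
  case False
  then obtain f0 h0 where f0: "f0 \<in> \<F>" and h0: "h0 \<in> \<H>" by auto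
  let ?E = "emp_gaussian_complexity n x \<H>" and ?W = "worst_gaussian_complexity n X \<H> \<F>"
  let ?G = "emp_gaussian_complexity n x (class_comp \<F> \<H>)"
  have W: "emp_gaussian_complexity n (\<lambda>i. h (x i)) \<F> \<le> ?W" if "h \<in> \<H>" for h
    unfolding worst_gaussian_complexity_def
    using that inputs by (intro SUP_upper2[OF that] SUP_upper) auto
  have E0: "0 \<le> ?E" using False by (intro emp_gaussian_complexity_nonneg) auto
  have W0: "0 \<le> ?W"
    using emp_gaussian_complexity_nonneg[of \<F> n "\<lambda>i. h0 (x i)"] W[OF h0] False by (auto intro: order_trans)
  have L0: "0 \<le> L" using lipschitz[OF f0] by (rule lipschitz_on_nonneg)
  have D0: "0 \<le> D" using bounded[OF f0 h0 inputs[of 1]] n by (auto intro: order_trans[OF norm_ge_zero])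
  have C0: "0 \<le> C" using E0 W0 L0 by (simp add: C)
  have trivial: "?G \<le> ereal (sqrt (real (k - 1)) * D)"
    unfolding k[symmetric]
    by (rule emp_gaussian_complexity_bounded[OF n _ D0])
      (use bounded inputs in \<open>auto simp: class_comp_def\<close>)
  have ln0: "0 \<le> ln (real n)" using n by simp
  then have C_ln: "0 \<le> 512 * C * ereal (ln (real n))"
    using C0 by (intro ereal_0_le_mult) auto
  \<comment> \<open>For \<open>n = 1\<close> the logarithm vanishes and for \<open>D = 0\<close> the
    chaining radius does; infinite \<open>C\<close> makes the right side infinite because
    \<open>ln n > 0\<close>.\<close>
  consider "n = 1 \<or> D = 0" | "n \<ge> 2" "0 < D" "C = \<infinity>" | r where "n \<ge> 2" "0 < D" "C = ereal r" "0 \<le> r"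
    using n D0 C0 by (cases C) force+
  then show ?thesis
  proof cases
    case 1
    then have "sqrt (real (k - 1)) * D \<le> 8 * sqrt (real (k - 1)) * D / (real n)\<^sup>2"
      using D0 by auto
    then have "?G \<le> ereal (8 * sqrt (real (k - 1)) * D / (real n)\<^sup>2)"
      using trivial by (meson ereal_less_eq(3) order_trans)
    then show ?thesis using C_ln by (simp add: add_increasing2)
  next
    case 2
    then have "0 < ln (real n)" by simp
    then have *: "512 * C * ereal (ln (real n)) = \<infinity>" using 2 by simp
    show ?thesis unfolding * by simp
  next
    case 3
    then have "ln 2 \<le> ln (real n)" by (intro ln_mono) auto
    then have ln_n: "0 < ln (real n)" "2 * ln (real n) \<ge> 1"
      using ln2_ge_two_thirds by linarith+
    show ?thesis
    proof (cases "L = 0")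
      case True
      \<comment> \<open>Every \<open>f\<close> is constant here, so the composed class gives the
        same vectors as the outer class along \<open>h0\<close>. Since
        \<open>0 * \<infinity> = 0\<close> for extended reals, finiteness of \<open>C\<close> says
        nothing about \<open>?E\<close> in this case.\<close>
      have eq: "coord x (f \<circ> h) = coord (\<lambda>i. h0 (x i)) f" if "f \<in> \<F>" for f h
      proof -
        have "f (h (x i)) = f (h0 (x i))" for i
          using lipschitz_onD[OF lipschitz[OF that], of "h (x i)" "h0 (x i)"] True by simp
        then show ?thesis by (simp add: coord_def)
      qed
      have "?G \<le> emp_gaussian_complexity n (\<lambda>i. h0 (x i)) \<F>"
        unfolding emp_gaussian_complexity_dotp
        by (intro ereal_expectation_mono SUP_least) (auto simp: class_comp_def eq intro: SUP_upper)
      also have "\<dots> \<le> ereal r" using W[OF h0] True 3 by (simp add: C flip: zero_ereal_def)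
      also have "r \<le> 512 * r * ln n"
        using 3 ln_n mult_left_mono[of 1 "2 * ln n" r] by simp
      also have "\<dots> \<le> 8 * sqrt (real (k - 1)) * D / (real n)\<^sup>2 + 512 * r * ln n"
        using D0 by simp
      finally show ?thesis using 3 by simp
    next
      case False
      then have L: "0 < L" using L0 by simp
      obtain a b where ab: "?E = ereal a" "?W = ereal b" "r = L * a + b"
        using E0 W0 3(3) L unfolding C by (cases ?E; cases ?W) auto
      show ?thesis
      proof (rule ereal_le_epsilon2)
        fix e :: real assume e: "0 < e"
        \<comment> \<open>\<open>emp_gaussian_complexity_comp_le\<close> wants a strict upper bound
          for \<open>r\<close>; the slack \<open>\<delta>\<close> is scaled to cost exactly
          \<open>e\<close>, which is arbitrary.\<close>
        define \<delta> where "\<delta> = e / (512 * ln n)"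
        have \<delta>: "0 < \<delta>" "512 * \<delta> * ln n = e" using e ln_n by (auto simp: \<delta>_def)
        have "?G \<le> ereal (sqrt CARD('q) * D / (real n)\<^sup>2 + 510 * (r + \<delta>) * ln n)"
        proof (rule emp_gaussian_complexity_comp_le[OF 3(1) L 3(2)])
          show "norm (f (h (x i))) \<le> D" if "f \<in> \<F>" "h \<in> \<H>" "i \<in> {1..n}" for f h i
            using bounded[OF that(1,2) inputs[OF that(3)]] by simp
          show "emp_gaussian_complexity n (\<lambda>i. h (x i)) \<F> \<le> ereal b" if "h \<in> \<H>" for h
            using W[OF that] by (simp add: ab)
        qed (use \<open>\<not> (\<F> = {} \<or> \<H> = {})\<close> lipschitz ab \<delta> in auto)
        also have "sqrt CARD('q) * D / (real n)\<^sup>2 + 510 * (r + \<delta>) * ln n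
            \<le> 8 * sqrt (real (k - 1)) * D / (real n)\<^sup>2 + 512 * (r + \<delta>) * ln n"
        proof (rule add_mono)
          show "sqrt CARD('q) * D / (real n)\<^sup>2 \<le> 8 * sqrt (real (k - 1)) * D / (real n)\<^sup>2"
            unfolding k using D0 by (intro divide_right_mono) auto
          show "510 * (r + \<delta>) * ln n \<le> 512 * (r + \<delta>) * ln n"
            using 3 \<delta> ln_n by (intro mult_right_mono) auto
        qed
        also have "\<dots> = 8 * sqrt (real (k - 1)) * D / (real n)\<^sup>2 + 512 * r * ln n + e"
          using \<delta>(2) by (simp add: algebra_simps)
        finally show "?G \<le> ereal (8 * sqrt (real (k - 1)) * D / (real n)\<^sup>2)
            + 512 * C * ereal (ln (real n)) + ereal e"
          using 3 by simp
      qed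
    qed
  qed
qed

end
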